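(* Let $(\Omega,\mathscr{F},\mu)$ be a complete probability space, $K\subset L^{0}(\mu)$ absolutely convex, closed in probability and bounded in probability, and $E_K=\mathrm{span}(K)$. Let $\varphi:E_K\to(-\infty,\infty]$ be convex and proper. Let $\tau$ be a locally convex equicontinuous Köthe topology on $E_K$ with the Krein-Šmulian property which is $F$-regular. Then the following are equivalent: (1) $\varphi$ is lower semicontinuous with respect to $\tau$; (2) for every $f\in E_K$, \[ \varphi(f)=\sup_{g\in F}\left\{\int_\Omega fg\,d\mu-\varphi^{\ast}(g)\right\},\qquad\text{where }\varphi^{\ast}(g)=\sup_{h\in E_K}\left\{\int_\Omega hg\,d\mu-\varphi(h)\right\}; \] (3) $\varphi$ has the equicontinuous Fatou property.
   Context: $L^{0}(\mu)$ carries the topology of convergence in probability. The polar of $C\subset L^{0}(\mu)$ is $C^{\circ}=\{g\in L^{0}(\mu):\sup_{f\in C}\int_\Omega|fg|\,d\mu\leq1\}$; set $E'_K=\mathrm{span}(K^{\circ})$, paired with $E_K$ via $\langle f,g\rangle=\int_\Omega fg\,d\mu$; for $F\subset E'_K$, $\sigma(E_K,F)$ is the associated weak topology on $E_K$. A set or sequence is $K$-bounded if it is contained in $\lambda K$ for some $\lambda>0$. A convex proper $\varphi$ has the equicontinuous Fatou property if every $K$-bounded sequence $(f_n)$ converging in probability to $f\in E_K$ satisfies $\varphi(f)\leq\liminf_n\varphi(f_n)$. A topology $\tau$ on $E_K$ is an equicontinuous Köthe topology if $K$ is $\tau$-compact and $\tau$ restricted to $K$-bounded sets equals $\sigma(E_K,F)$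 for some $F\subset E'_K$ that is solid, separates the points of $E_K$, and contains a strictly positive element; $F$ is then said to induce $\tau$. Such $\tau$ has the Krein-Šmulian property if a convex set $C\subset E_K$ is $\tau$-closed iff $C\cap\lambda K$ is $\tau$-closed for each $\lambda>0$. When $\tau$ has the Krein-Šmulian property and is induced by $F$, each $g\in F$ gives a $\tau$-continuous functional $f\mapsto\int_\Omega fg\,d\mu$, yielding a natural map $F\to(E_K,\tau)^{\ast}$ (the topological dual); $\tau$ is $F$-regular if $F$ induces $\tau$ and this natural map is surjective. *)

theory Defs
  imports "HOL-Probability.Probability"
begin

text \<open>Elements of L0(mu) are represented by real-valued M-measurable functions;
  two representatives are identified when they agree almost everywhere.\<close>

definition L0 :: "'a measure \<Rightarrow> ('a \<Rightarrow> real) set" where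
  "L0 M = borel_measurable M"

definition conv_in_prob :: "'a measure \<Rightarrow> (nat \<Rightarrow> 'a \<Rightarrow> real) \<Rightarrow> ('a \<Rightarrow> real) \<Rightarrow> bool" where
  "conv_in_prob M fs f \<longleftrightarrow> (\<forall>e>0.
     (\<lambda>n. measure M {x \<in> space M. e < \<bar>fs n x - f x\<bar>}) \<longlonglongrightarrow> 0)"

text \<open>The topology of convergence in probability is metrizable, so closedness is sequential closedness.\<close>
definition closed_in_prob :: "'a measure \<Rightarrow> ('a \<Rightarrow> real) set \<Rightarrow> bool" where
  "closed_in_prob M C \<longleftrightarrow> C \<subseteq> L0 M \<and>
     (\<forall>fs f. (\<forall>n. fs n \<in> C) \<longrightarrow> f \<in> L0 M \<longrightarrow> conv_in_prob M fs f \<longrightarrow> f \<in> C)"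

definition bounded_in_prob :: "'a measure \<Rightarrow> ('a \<Rightarrow> real) set \<Rightarrow> bool" where
  "bounded_in_prob M C \<longleftrightarrow> C \<subseteq> L0 M \<and>
     (\<forall>e>0. \<exists>l>0. \<forall>f\<in>C. measure M {x \<in> space M. l < \<bar>f x\<bar>} \<le> e)"

definition abs_convex :: "('a \<Rightarrow> real) set \<Rightarrow> bool" where
  "abs_convex C \<longleftrightarrow> (\<forall>f\<in>C. \<forall>g\<in>C. \<forall>a b::real. \<bar>a\<bar> + \<bar>b\<bar> \<le> 1 \<longrightarrow>
     (\<lambda>x. a * f x + b * g x) \<in> C)"

definition convex_fset :: "('a \<Rightarrow> real) set \<Rightarrow> bool" where
  "convex_fset C \<longleftrightarrow> (\<forall>f\<in>C. \<forall>g\<in>C. \<forall>t::real. 0 \<le> t \<and> t \<le> 1 \<longrightarrow>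
     (\<lambda>x. t * f x + (1 - t) * g x) \<in> C)"

definition fspan :: "('a \<Rightarrow> real) set \<Rightarrow> ('a \<Rightarrow> real) set" where
  "fspan S = {f. \<exists>(n::nat) (c::nat \<Rightarrow> real) h. (\<forall>i<n. h i \<in> S) \<and>
                 f = (\<lambda>x. \<Sum>i<n. c i * h i x)}"

definition scale_set :: "real \<Rightarrow> ('a \<Rightarrow> real) set \<Rightarrow> ('a \<Rightarrow> real) set" where
  "scale_set l C = (\<lambda>f. (\<lambda>x. l * f x)) ` C"

definition K_bounded :: "('a \<Rightarrow> real) set \<Rightarrow> ('a \<Rightarrow> real) set \<Rightarrow> bool" where
  "K_bounded K C \<longleftrightarrow> (\<exists>l>0. C \<subseteq> scale_set l K)"

definition polar :: "'a measure \<Rightarrow> ('a \<Rightarrow> real) set \<Rightarrow> ('a \<Rightarrow> real) set" where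
  "polar M C = {g \<in> L0 M. \<forall>f\<in>C. (\<integral>\<^sup>+ x. ennreal \<bar>f x * g x\<bar> \<partial>M) \<le> 1}"

definition dual_space :: "'a measure \<Rightarrow> ('a \<Rightarrow> real) set \<Rightarrow> ('a \<Rightarrow> real) set" where
  "dual_space M K = fspan (polar M K)"

definition pairing :: "'a measure \<Rightarrow> ('a \<Rightarrow> real) \<Rightarrow> ('a \<Rightarrow> real) \<Rightarrow> real" where
  "pairing M f g = (\<integral>x. f x * g x \<partial>M)"

definition weak_top :: "'a measure \<Rightarrow> ('a \<Rightarrow> real) set \<Rightarrow> ('a \<Rightarrow> real) set \<Rightarrow> ('a \<Rightarrow> real) topology" where
  "weak_top M E F = pullback_topology E (\<lambda>f. restrict (\<lambda>g. pairing M f g) F)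
                       (product_topology (\<lambda>_. euclideanreal) F)"

definition solid :: "'a measure \<Rightarrow> ('a \<Rightarrow> real) set \<Rightarrow> bool" where
  "solid M F \<longleftrightarrow> (\<forall>g\<in>F. \<forall>h\<in>L0 M. (AE x in M. \<bar>h x\<bar> \<le> \<bar>g x\<bar>) \<longrightarrow> h \<in> F)"

definition separates_points :: "'a measure \<Rightarrow> ('a \<Rightarrow> real) set \<Rightarrow> ('a \<Rightarrow> real) set \<Rightarrow> bool" where
  "separates_points M E F \<longleftrightarrow> (\<forall>f1\<in>E. \<forall>f2\<in>E. \<not> (AE x in M. f1 x = f2 x) \<longrightarrow>
      (\<exists>g\<in>F. pairing M f1 g \<noteq> pairing M f2 g))"

definition has_strictly_pos :: "'a measure \<Rightarrow> ('a \<Rightarrow> real) set \<Rightarrow> bool" where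
  "has_strictly_pos M F \<longleftrightarrow> (\<exists>g\<in>F. AE x in M. 0 < g x)"

definition locally_convex_top :: "('a \<Rightarrow> real) set \<Rightarrow> ('a \<Rightarrow> real) topology \<Rightarrow> bool" where
  "locally_convex_top E T \<longleftrightarrow> topspace T = E \<and>
     continuous_map (prod_topology T T) T (\<lambda>(f, g). (\<lambda>x. f x + g x)) \<and>
     continuous_map (prod_topology euclideanreal T) T (\<lambda>(c, f). (\<lambda>x. c * f x)) \<and>
     (\<forall>f U. openin T U \<and> f \<in> U \<longrightarrow> (\<exists>V. openin T V \<and> convex_fset V \<and> f \<in> V \<and> V \<subseteq> U))"

definition induces :: "'a measure \<Rightarrow> ('a \<Rightarrow> real) set \<Rightarrow> ('a \<Rightarrow> real) set \<Rightarrow> ('a \<Rightarrow> real) topology \<Rightarrow> bool" where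
  "induces M K F T \<longleftrightarrow> topspace T = fspan K \<and> compactin T K \<and>
     F \<subseteq> dual_space M K \<and> solid M F \<and> separates_points M (fspan K) F \<and> has_strictly_pos M F \<and>
     (\<forall>B. B \<subseteq> fspan K \<longrightarrow> K_bounded K B \<longrightarrow>
        subtopology T B = subtopology (weak_top M (fspan K) F) B)"

definition equicont_Koethe :: "'a measure \<Rightarrow> ('a \<Rightarrow> real) set \<Rightarrow> ('a \<Rightarrow> real) topology \<Rightarrow> bool" where
  "equicont_Koethe M K T \<longleftrightarrow> (\<exists>F. induces M K F T)"

definition Krein_Smulian :: "('a \<Rightarrow> real) set \<Rightarrow> ('a \<Rightarrow> real) topology \<Rightarrow> bool" where
  "Krein_Smulian K T \<longleftrightarrow> (\<forall>C. C \<subseteq> fspan K \<longrightarrow> convex_fset C \<longrightarrow>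
     (closedin T C \<longleftrightarrow> (\<forall>l>0. closedin T (C \<inter> scale_set l K))))"

definition top_dual :: "('a \<Rightarrow> real) set \<Rightarrow> ('a \<Rightarrow> real) topology \<Rightarrow> (('a \<Rightarrow> real) \<Rightarrow> real) set" where
  "top_dual E T = {l. continuous_map T euclideanreal l \<and>
     (\<forall>f\<in>E. \<forall>g\<in>E. \<forall>a b. l (\<lambda>x. a * f x + b * g x) = a * l f + b * l g)}"

definition F_regular :: "'a measure \<Rightarrow> ('a \<Rightarrow> real) set \<Rightarrow> ('a \<Rightarrow> real) set \<Rightarrow> ('a \<Rightarrow> real) topology \<Rightarrow> bool" where
  "F_regular M K F T \<longleftrightarrow> induces M K F T \<and>
     (\<forall>l\<in>top_dual (fspan K) T. \<exists>g\<in>F. \<forall>f\<in>fspan K. l f = pairing M f g)"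

definition convex_fun :: "('a \<Rightarrow> real) set \<Rightarrow> (('a \<Rightarrow> real) \<Rightarrow> ereal) \<Rightarrow> bool" where
  "convex_fun E \<phi> \<longleftrightarrow> (\<forall>f\<in>E. \<forall>g\<in>E. \<forall>t::real. 0 \<le> t \<and> t \<le> 1 \<longrightarrow>
     \<phi> (\<lambda>x. t * f x + (1 - t) * g x) \<le> ereal t * \<phi> f + ereal (1 - t) * \<phi> g)"

definition proper_fun :: "('a \<Rightarrow> real) set \<Rightarrow> (('a \<Rightarrow> real) \<Rightarrow> ereal) \<Rightarrow> bool" where
  "proper_fun E \<phi> \<longleftrightarrow> (\<forall>f\<in>E. \<phi> f \<noteq> -\<infinity>) \<and> (\<exists>f\<in>E. \<phi> f \<noteq> \<infinity>)"

definition lsc_top :: "('a \<Rightarrow> real) topology \<Rightarrow> (('a \<Rightarrow> real) \<Rightarrow> ereal) \<Rightarrow> bool" where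
  "lsc_top T \<phi> \<longleftrightarrow> (\<forall>f\<in>topspace T. \<forall>c. c < \<phi> f \<longrightarrow>
     (\<exists>U. openin T U \<and> f \<in> U \<and> (\<forall>h\<in>U. c < \<phi> h)))"

definition conj_fun :: "'a measure \<Rightarrow> ('a \<Rightarrow> real) set \<Rightarrow> (('a \<Rightarrow> real) \<Rightarrow> ereal) \<Rightarrow> ('a \<Rightarrow> real) \<Rightarrow> ereal" where
  "conj_fun M E \<phi> g = (SUP h\<in>E. ereal (pairing M h g) - \<phi> h)"

definition equicont_Fatou :: "'a measure \<Rightarrow> ('a \<Rightarrow> real) set \<Rightarrow> (('a \<Rightarrow> real) \<Rightarrow> ereal) \<Rightarrow> bool" where
  "equicont_Fatou M K \<phi> \<longleftrightarrow> (\<forall>fs f. K_bounded K (range fs) \<longrightarrow> f \<in> fspan K \<longrightarrow>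
     conv_in_prob M fs f \<longrightarrow> \<phi> f \<le> liminf (\<lambda>n. \<phi> (fs n)))"

end

theory Submission
  imports Defs "HOL-Library.Function_Algebras"
begin

text \<open>The implication from lower semicontinuity to the dual representation is the Fenchel-Moreau
  theorem in \<open>(E, T)\<close>, whose continuous functionals are given by \<open>F\<close>; it rests on the Hahn-Banach
  theorem, obtained from a maximal convex cone in \<open>E \<times> \<real>\<close>. For the Fatou property implying lower
  semicontinuity, the Krein-Smulian property reduces the claim to convex subsets \<open>C\<close> of multiples
  of \<open>K\<close> that are closed in probability. A point \<open>f0\<close> outside \<open>C\<close> is separated from it by an
  element of \<open>F\<close> read off from the minimiser over \<open>C\<close> of \<open>\<integral> sqrt (1 + (f - f0)\<^sup>2) w\<close> with a strictly
  positive weight \<open>w \<in> F\<close>, without duality theory for \<open>L\<^sup>1\<close>. Conversely, a \<open>K\<close>-bounded sequence that converges in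
  probability has, by compactness of \<open>K\<close>, a \<open>T\<close>-cluster point along every subsequence, and it
  agrees almost everywhere with the limit because \<open>F\<close> is solid and separates points.\<close>

section \<open>A Hahn-Banach theorem for convex cones\<close>

text \<open>Elements of \<open>E\<close> are only known to be integrable against \<open>F\<close>,
  and this dictates the integrand. It must grow at most linearly to have a finite integral, be
  convex enough for minimising sequences to converge almost everywhere, and have a bounded
  derivative, so that solidity puts the derivative times \<open>w\<close> into \<open>F\<close>. The
  absolute value fails the second requirement, the square the first and the third; the square root
  meets all three. The other obstacle is that \<open>T\<close> is described explicitly on
  \<open>K\<close>-bounded sets only. Continuity of the pairings on all of \<open>E\<close>, needed
  both for separation and for deducing lower semicontinuity from the dual representation, has to be
  recovered from the Krein-Smulian property. Hahn-Banach is phrased with a cone because the affine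
  minorant obeys two bounds at once, one against the epigraph and one on a neighbourhood of zero;
  the sum of two cones expresses both.\<close>

instantiation "fun" :: (type, real_vector) real_vector
begin

definition scaleR_fun :: "real \<Rightarrow> ('a \<Rightarrow> 'b) \<Rightarrow> 'a \<Rightarrow> 'b"
  where "scaleR_fun c f = (\<lambda>x. c *\<^sub>R f x)"

instance
  by standard (auto simp: scaleR_fun_def fun_eq_iff algebra_simps)

end

lemma scaleR_fun_apply [simp]: "(c *\<^sub>R f) x = c *\<^sub>R f x"
  by (simp add: scaleR_fun_def)

text \<open>\<open>G\<close> acts as the epigraph of a sublinear bound. Enlarging the cone lowers
  its lower boundary; for a maximal cone without any \<open>(0, r)\<close>, \<open>r < 0\<close>,
  that boundary is attained and odd, hence linear. \<open>total\<close> keeps the infimum from being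
  taken over the empty set, \<open>pos\<close> keeps it bounded below.\<close>

lemma convex_cone_majorizes_linear:
  fixes G :: "('v::real_vector \<times> real) set"
  assumes E: "subspace E" and G: "convex_cone G" and GE: "G \<subseteq> E \<times> UNIV"
    and total: "\<And>x. x \<in> E \<Longrightarrow> \<exists>r. (x, r) \<in> G"
    and pos: "\<And>r. (0, r) \<in> G \<Longrightarrow> 0 \<le> r"
  shows "\<exists>l. (\<forall>x\<in>E. \<forall>y\<in>E. \<forall>a b. l (a *\<^sub>R x + b *\<^sub>R y) = a * l x + b * l y)
           \<and> (\<forall>x r. (x, r) \<in> G \<longrightarrow> l x \<le> r)"
proof -
  define \<A> where "\<A> = {H. convex_cone H \<and> G \<subseteq> H \<and> H \<subseteq> E \<times> UNIV \<and> (\<forall>r. (0, r) \<in> H \<longrightarrow> 0 \<le> r)}"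
  have "\<exists>H\<in>\<A>. \<forall>X\<in>\<A>. H \<subseteq> X \<longrightarrow> X = H"
  proof (rule subset_Zorn_nonempty)
    have "G \<in> \<A>"
      using G GE pos by (auto simp: \<A>_def)
    then show "\<A> \<noteq> {}"
      by blast
  next
    fix \<C> assume ne: "\<C> \<noteq> {}" and ch: "subset.chain \<A> \<C>"
    have sub: "\<And>H. H \<in> \<C> \<Longrightarrow> H \<in> \<A>"
      using ch by (auto simp: subset.chain_def)
    have "x + y \<in> \<Union>\<C>" if xy: "x \<in> \<Union>\<C>" "y \<in> \<Union>\<C>" for x y
    proof -
      obtain X Y where XY: "X \<in> \<C>" "Y \<in> \<C>" "x \<in> X" "y \<in> Y"
        using xy by blast
      then have "X \<subseteq> Y \<or> Y \<subseteq> X"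
        using ch by (auto simp: subset.chain_def)
      then have "x + y \<in> X \<or> x + y \<in> Y"
        using XY sub[of X] sub[of Y] convex_cone_add[of X x y] convex_cone_add[of Y x y]
        by (auto simp: \<A>_def)
      then show ?thesis
        using XY by blast
    qed
    moreover have "c *\<^sub>R x \<in> \<Union>\<C>" if xc: "x \<in> \<Union>\<C>" "0 \<le> c" for x c
    proof -
      obtain X where "X \<in> \<C>" "x \<in> X"
        using xc by blast
      then show ?thesis
        using sub[of X] convex_cone_scaleR[of X c x] xc(2) by (auto simp: \<A>_def)
    qed
    moreover have "0 \<in> \<Union>\<C>"
    proof -
      obtain X where "X \<in> \<C>"
        using ne by blast
      then show ?thesis
        using sub[of X] convex_cone_contains_0[of X] by (auto simp: \<A>_def)
    qed
    ultimately have "convex_cone (\<Union>\<C>)"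
      unfolding convex_cone_iff by blast
    then show "\<Union>\<C> \<in> \<A>"
      using ne sub unfolding \<A>_def by blast
  qed
  then obtain H where H: "H \<in> \<A>" and maxi: "\<And>X. X \<in> \<A> \<Longrightarrow> H \<subseteq> X \<Longrightarrow> X = H"
    by blast
  have cone: "convex_cone H" and GH: "G \<subseteq> H" and HE: "H \<subseteq> E \<times> UNIV"
    and Hpos: "\<And>r. (0, r) \<in> H \<Longrightarrow> 0 \<le> r"
    using H by (auto simp: \<A>_def)
  have sum: "(x + y, r + s) \<in> H" if "(x, r) \<in> H" "(y, s) \<in> H" for x y r s
    using convex_cone_add[OF cone that] by simp
  have scale: "(c *\<^sub>R x, c * r) \<in> H" if "(x, r) \<in> H" "0 \<le> c" for x r c
    using convex_cone_scaleR[OF cone that(2,1)] by simp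
  \<comment> \<open>Adjoining the ray through \<open>(- x, - a)\<close> keeps the cone admissible, so maximality forces it into \<open>H\<close>.\<close>
  have ray: "(- x, - a) \<in> H" if x: "x \<in> E" and a: "\<And>r. (x, r) \<in> H \<Longrightarrow> a \<le> r" for x a
  proof -
    define R where "R = {(- s *\<^sub>R x, - s * a) |s. 0 \<le> s}"
    define H' where "H' = (\<Union>p\<in>H. \<Union>q\<in>R. {p + q})"
    have R0: "(0, 0) \<in> R"
      by (force simp: R_def)
    have coneR: "convex_cone R"
      unfolding convex_cone_iff
    proof (intro conjI ballI allI impI)
      show "0 \<in> R" using R0 by (simp add: zero_prod_def)
    next
      fix u v assume "u \<in> R" "v \<in> R"
      then obtain s t where "u = (- s *\<^sub>R x, - s * a)" "v = (- t *\<^sub>R x, - t * a)" "0 \<le> s" "0 \<le> t"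
        by (auto simp: R_def)
      then show "u + v \<in> R"
        unfolding R_def by (intro CollectI exI[of _ "s + t"]) (auto simp: algebra_simps)
    next
      fix u and c :: real assume "u \<in> R" "0 \<le> c"
      then obtain s where "u = (- s *\<^sub>R x, - s * a)" "0 \<le> s"
        by (auto simp: R_def)
      then show "c *\<^sub>R u \<in> R"
        using \<open>0 \<le> c\<close> unfolding R_def by (intro CollectI exI[of _ "c * s"]) (auto simp: algebra_simps)
    qed
    have coneH': "convex_cone H'"
      unfolding H'_def by (rule convex_cone_sums[OF cone coneR])
    have HH': "H \<subseteq> H'"
    proof
      fix p assume "p \<in> H"
      then show "p \<in> H'"
        using R0 unfolding H'_def by (intro UN_I[of p] UN_I[of "(0,0)"]) (auto simp: zero_prod_def[symmetric])
    qed
    have "0 \<le> r" if r: "(0, r) \<in> H'" for r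
    proof -
      obtain y q s where *: "(y, q) \<in> H" "0 \<le> s" "0 = y - s *\<^sub>R x" "r = q - s * a"
        using r by (auto simp: H'_def R_def)
      show ?thesis
      proof (cases "s = 0")
        case True
        then show ?thesis using * Hpos by simp
      next
        case False
        then have "((1/s) *\<^sub>R y, (1/s) * q) \<in> H" using * by (intro scale) auto
        moreover have "(1/s) *\<^sub>R y = x" using * False by simp
        ultimately have "a \<le> (1/s) * q" using a by simp
        then show ?thesis using * False by (simp add: field_simps)
      qed
    qed
    moreover have "H' \<subseteq> E \<times> UNIV"
      using HE x E unfolding H'_def R_def
      by (auto intro!: subspace_add subspace_diff subspace_scale)
    ultimately have "H' = H"
      using coneH' HH' GH by (intro maxi) (auto simp: \<A>_def)
    moreover have "(- x, - a) \<in> H'"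
    proof -
      have "(- x, - a) \<in> R"
        unfolding R_def by (intro CollectI exI[of _ 1]) auto
      moreover have "0 \<in> H" using cone by (rule convex_cone_contains_0)
      ultimately show ?thesis unfolding H'_def by force
    qed
    ultimately show ?thesis by simp
  qed
  define l where "l x = Inf {r. (x, r) \<in> H}" for x
  have ne: "\<exists>r. (x, r) \<in> H" if "x \<in> E" for x
    using total[OF that] GH by blast
  have bdd: "bdd_below {r. (x, r) \<in> H}" if x: "x \<in> E" for x
  proof -
    obtain s where s: "(- x, s) \<in> H" using ne[of "- x"] subspace_neg[OF E x] by blast
    have "- s \<le> r" if "(x, r) \<in> H" for r
      using sum[OF that s] Hpos[of "r + s"] by simp
    then show ?thesis by (intro bdd_belowI[of _ "- s"]) simp
  qed
  have l_le: "l x \<le> r" if "(x, r) \<in> H" for x r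
    unfolding l_def using that HE by (intro cInf_lower bdd) auto
  \<comment> \<open>The infimum is itself a lower bound, so \<open>ray\<close> applies with
    \<open>a = l x\<close>.\<close>
  have l_ray: "(- x, - l x) \<in> H" if "x \<in> E" for x
    using that l_le by (rule ray)
  have l_neg: "l (- x) = - l x" if "x \<in> E" for x
  proof -
    have "(x, - l (- x)) \<in> H"
      using l_ray[of "- x"] subspace_neg[OF E that] by simp
    from sum[OF this l_ray[OF that]] have "(0, - l (- x) - l x) \<in> H"
      by simp
    then have "0 \<le> - l (- x) - l x"
      by (rule Hpos)
    moreover have "0 \<le> l (- x) + l x"
    proof -
      have "- l (- x) \<le> l x"
        unfolding l_def[of x]
      proof (rule cInf_greatest)
        show "{r. (x, r) \<in> H} \<noteq> {}" using ne[OF that] by auto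
        fix r assume "r \<in> {r. (x, r) \<in> H}"
        then have xr: "(x, r) \<in> H" by simp
        have "- r \<le> l (- x)"
          unfolding l_def
        proof (rule cInf_greatest)
          show "{r. (- x, r) \<in> H} \<noteq> {}" using ne subspace_neg[OF E that] by auto
          fix s assume "s \<in> {r. (- x, r) \<in> H}"
          then show "- r \<le> s" using sum[OF xr, of "- x" s] Hpos[of "r + s"] by simp
        qed
        then show "- l (- x) \<le> r" by simp
      qed
      then show ?thesis by simp
    qed
    ultimately show ?thesis by simp
  qed
  have graph: "(c *\<^sub>R x, c * l x) \<in> H" if "x \<in> E" for x c
  proof (cases "0 \<le> c")
    case True
    have "(x, l x) \<in> H" using l_ray[of "- x"] l_neg subspace_neg[OF E] that by simp
    then show ?thesis using scale True by blast
  next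
    case False
    then show ?thesis using scale[OF l_ray[OF that], of "- c"] by simp
  qed
  have le: "l (a *\<^sub>R x + b *\<^sub>R y) \<le> a * l x + b * l y" if "x \<in> E" "y \<in> E" for x y a b
    by (intro l_le sum graph that)
  \<comment> \<open>The reverse inequality is \<open>le\<close> for \<open>- a\<close> and
    \<open>- b\<close>, turned around by oddness of \<open>l\<close>.\<close>
  have "l (a *\<^sub>R x + b *\<^sub>R y) = a * l x + b * l y" if "x \<in> E" "y \<in> E" for x y a b
  proof -
    have "a *\<^sub>R x + b *\<^sub>R y \<in> E" using that E by (intro subspace_add subspace_scale)
    from l_neg[OF this] have "l ((- a) *\<^sub>R x + (- b) *\<^sub>R y) = - l (a *\<^sub>R x + b *\<^sub>R y)"
      by simp
    then show ?thesis
      using le[OF that, of a b] le[OF that, of "- a" "- b"] by linarith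
  qed
  then show ?thesis using l_le GH by blast
qed

section \<open>Affine minorants of convex functions\<close>

text \<open>Opens the library on convex sets and cones, through the pointwise vector space structure
  on functions.\<close>

lemma convex_fset_iff_convex: "convex_fset C \<longleftrightarrow> convex C"
proof
  assume C: "convex_fset C"
  show "convex C"
  proof (rule convexI)
    fix x y u v assume "x \<in> C" "y \<in> C" "0 \<le> u" "0 \<le> v" "u + v = (1::real)"
    then have "(\<lambda>z. u * x z + (1 - u) * y z) \<in> C" "v = 1 - u"
      using C by (auto simp: convex_fset_def)
    moreover have "u *\<^sub>R x + (1 - u) *\<^sub>R y = (\<lambda>z. u * x z + (1 - u) * y z)"
      by (auto simp: fun_eq_iff)
    ultimately show "u *\<^sub>R x + v *\<^sub>R y \<in> C" by simp
  qed
next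
  assume C: "convex C"
  show "convex_fset C"
    unfolding convex_fset_def
  proof (intro ballI allI impI)
    fix f g and t :: real assume "f \<in> C" "g \<in> C" "0 \<le> t \<and> t \<le> 1"
    then have "t *\<^sub>R f + (1 - t) *\<^sub>R g \<in> C"
      using C by (intro convexD) auto
    moreover have "t *\<^sub>R f + (1 - t) *\<^sub>R g = (\<lambda>z. t * f z + (1 - t) * g z)"
      by (auto simp: fun_eq_iff)
    ultimately show "(\<lambda>x. t * f x + (1 - t) * g x) \<in> C" by simp
  qed
qed

lemma top_dual_iff:
  "l \<in> top_dual E T \<longleftrightarrow> continuous_map T euclideanreal l \<and>
     (\<forall>f\<in>E. \<forall>g\<in>E. \<forall>a b. l (a *\<^sub>R f + b *\<^sub>R g) = a * l f + b * l g)"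
proof -
  have "a *\<^sub>R f + b *\<^sub>R g = (\<lambda>x. a * f x + b * g x)" for a b and f g :: "'a \<Rightarrow> real"
    by (auto simp: fun_eq_iff)
  then show ?thesis by (simp add: top_dual_def)
qed

context
  fixes E :: "('a \<Rightarrow> real) set" and T :: "('a \<Rightarrow> real) topology"
  assumes lc: "locally_convex_top E T"
begin

lemma topspace_lc: "topspace T = E"
  using lc by (simp add: locally_convex_top_def)

lemma continuous_map_lincomb:
  assumes f: "continuous_map X T f" and g: "continuous_map X T g"
    and c: "continuous_map X euclideanreal c"
  shows "continuous_map X T (\<lambda>x. c x *\<^sub>R f x + g x)"
proof -
  have add: "continuous_map (prod_topology T T) T (\<lambda>(f, g). f + g)"
    using lc by (simp add: locally_convex_top_def plus_fun_def)
  have scale: "continuous_map (prod_topology euclideanreal T) T (\<lambda>(c, f). c *\<^sub>R f)"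
    using lc by (simp add: locally_convex_top_def scaleR_fun_def)
  have "continuous_map X T ((\<lambda>(c, f). c *\<^sub>R f) \<circ> (\<lambda>x. (c x, f x)))"
    by (rule continuous_map_compose[OF _ scale]) (intro continuous_map_pairedI c f)
  then have "continuous_map X T (\<lambda>x. c x *\<^sub>R f x)"
    by (simp add: o_def)
  from continuous_map_compose[OF continuous_map_pairedI[OF this g] add] show ?thesis
    by (simp add: o_def)
qed

text \<open>Continuous maps into \<open>T\<close> take values in \<open>topspace T = E\<close>, so
  continuity of the operations already contains closure under them.\<close>

lemma subspace_lc:
  assumes "E \<noteq> {}"
  shows "subspace E"
proof -
  obtain e where e: "e \<in> E" using assms by blast
  have comb: "c *\<^sub>R f + g \<in> E" if "f \<in> E" "g \<in> E" for c f g
  proof -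
    have "continuous_map T T (\<lambda>x. c *\<^sub>R x + g)"
      using that by (intro continuous_map_lincomb) (auto simp: topspace_lc)
    then show ?thesis
      using that by (auto simp: continuous_map_def topspace_lc Pi_def)
  qed
  have 0: "0 \<in> E" using comb[OF e e, of "- 1"] by simp
  show ?thesis
    unfolding subspace_def using 0 comb[of _ _ 1] comb[of _ 0] by auto
qed

lemma openin_affine_vimage:
  assumes "openin T U" "b \<in> E"
  shows "openin T {x \<in> E. a *\<^sub>R x + b \<in> U}"
proof -
  have "continuous_map T T (\<lambda>x. a *\<^sub>R x + b)"
    using assms by (intro continuous_map_lincomb) (auto simp: topspace_lc)
  from openin_continuous_map_preimage[OF this assms(1)] show ?thesis
    by (simp add: topspace_lc)
qed

lemma ex_symmetric_convex_nbhd: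
  assumes U: "openin T U" "f \<in> U"
  shows "\<exists>W. openin T W \<and> convex W \<and> 0 \<in> W \<and> (\<forall>w\<in>W. - w \<in> W) \<and> (\<forall>w\<in>W. f + w \<in> U)"
proof -
  have fE: "f \<in> E" using openin_subset[OF U(1)] U(2) topspace_lc by auto
  then have sub: "subspace E" by (intro subspace_lc) auto
  have "openin T {x \<in> E. 1 *\<^sub>R x + f \<in> U}"
    by (rule openin_affine_vimage[OF U(1) fE])
  moreover have "0 \<in> {x \<in> E. 1 *\<^sub>R x + f \<in> U}"
    using U(2) subspace_0[OF sub] by simp
  ultimately obtain V where V: "openin T V" "convex V" "0 \<in> V" "V \<subseteq> {x \<in> E. 1 *\<^sub>R x + f \<in> U}"
    using lc unfolding locally_convex_top_def convex_fset_iff_convex by blast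
  define W where "W = V \<inter> {x \<in> E. (- 1) *\<^sub>R x + 0 \<in> V}"
  have oW: "openin T W"
    unfolding W_def by (intro openin_Int V openin_affine_vimage subspace_0 sub)
  have W: "W = V \<inter> uminus -` V"
    using V(4) by (auto simp: W_def)
  have "convex (uminus -` V)"
    by (rule convex_linear_vimage[OF _ V(2)]) (auto intro!: linearI)
  then have cW: "convex W"
    unfolding W by (intro convex_Int V(2))
  have fW: "f + w \<in> U" if "w \<in> W" for w
  proof -
    have "w \<in> V"
      using that by (simp add: W)
    then have "1 *\<^sub>R w + f \<in> U"
      using V(4) by blast
    then show ?thesis by (simp add: add.commute[of f])
  qed
  have "0 \<in> W" "\<And>w. w \<in> W \<Longrightarrow> - w \<in> W"
    using V(3) by (simp_all add: W)
  then show ?thesis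
    using oW cW fW by metis
qed

text \<open>Since \<open>t *\<^sub>R x\<close> depends continuously on \<open>t\<close> and vanishes
  at \<open>t = 0\<close>, a small multiple of \<open>x\<close> lies in \<open>W\<close>.\<close>

lemma nbhd_absorbing:
  assumes W: "openin T W" "0 \<in> W" and x: "x \<in> E"
  shows "\<exists>s>0. \<exists>w\<in>W. x = s *\<^sub>R w"
proof -
  have sub: "subspace E" using x by (intro subspace_lc) auto
  have "continuous_map euclideanreal T (\<lambda>t. t *\<^sub>R x + 0)"
    using x subspace_0[OF sub] by (intro continuous_map_lincomb) (auto simp: topspace_lc)
  from openin_continuous_map_preimage[OF this W(1)] have "open {t. t *\<^sub>R x \<in> W}"
    by simp
  moreover have "0 \<in> {t. t *\<^sub>R x \<in> W}" using W(2) by simp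
  ultimately obtain e where e: "e > 0" "ball 0 e \<subseteq> {t. t *\<^sub>R x \<in> W}"
    using openE by blast
  then have "(e / 2) *\<^sub>R x \<in> W"
    by (auto simp: subset_iff)
  then show ?thesis
    using e(1) by (intro exI[of _ "2 / e"] conjI bexI[of _ "(e / 2) *\<^sub>R x"]) auto
qed

lemma continuous_map_bounded_linear:
  assumes W: "openin T W" "0 \<in> W" and bound: "\<And>w. w \<in> W \<Longrightarrow> \<bar>l w\<bar> \<le> N"
    and lin: "\<And>f g a b. f \<in> E \<Longrightarrow> g \<in> E \<Longrightarrow> l (a *\<^sub>R f + b *\<^sub>R g) = a * l f + b * l g"
  shows "continuous_map T euclideanreal l"
proof -
  have WE: "W \<subseteq> E" using openin_subset[OF W(1)] topspace_lc by auto
  then have sub: "subspace E" using W(2) by (intro subspace_lc) auto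
  have N: "0 \<le> N" using bound[OF W(2)] by linarith
  have nbhd: "\<exists>U. openin T U \<and> x \<in> U \<and> (\<forall>y\<in>U. \<bar>l y - l x\<bar> < e)" if x: "x \<in> E" and e: "e > 0" for x e
  proof -
    \<comment> \<open>The \<open>+ 1\<close> allows \<open>N = 0\<close> and makes
      \<open>d * N < e\<close> strict.\<close>
    define d where "d = e / (N + 1)"
    have d: "d > 0" using N e by (simp add: d_def)
    have "d * N < e" using N e by (simp add: d_def field_simps)
    have xd: "- (1/d) *\<^sub>R x \<in> E"
      using x sub by (intro subspace_scale)
    define U where "U = {y \<in> E. (1/d) *\<^sub>R y + - (1/d) *\<^sub>R x \<in> W}"
    have "openin T U"
      unfolding U_def by (rule openin_affine_vimage[OF W(1) xd])
    moreover have "x \<in> U"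
      using x W(2) by (simp add: U_def)
    moreover have "\<bar>l y - l x\<bar> < e" if y: "y \<in> U" for y
    proof -
      define w where "w = (1/d) *\<^sub>R y + - (1/d) *\<^sub>R x"
      have w: "w \<in> W" and yE: "y \<in> E" using y by (auto simp: U_def w_def)
      have "l w = (l y - l x) / d"
        unfolding w_def by (subst lin[OF yE x]) (simp add: diff_divide_distrib)
      then have "\<bar>l y - l x\<bar> = d * \<bar>l w\<bar>"
        using d by (simp add: abs_div)
      also have "\<dots> \<le> d * N" using bound[OF w] d by simp
      also have "\<dots> < e" by fact
      finally show ?thesis .
    qed
    ultimately show ?thesis by blast
  qed
  have "openin T {x \<in> topspace T. l x > a}" "openin T {x \<in> topspace T. l x < a}" for a
  proof -
    have "\<exists>U. openin T U \<and> x \<in> U \<and> U \<subseteq> {x \<in> E. l x > a}" if "x \<in> E" "l x > a" for x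
    proof -
      obtain U where U: "openin T U" "x \<in> U" "\<forall>y\<in>U. \<bar>l y - l x\<bar> < l x - a"
        using nbhd[of x "l x - a"] \<open>x \<in> E\<close> \<open>l x > a\<close> by auto
      have "a < l y" if "y \<in> U" for y
        using U(3) that by fastforce
      then show ?thesis
        using U openin_subset[OF U(1)] topspace_lc by blast
    qed
    then show "openin T {x \<in> topspace T. l x > a}"
      by (subst openin_subopen) (auto simp: topspace_lc)
    have "\<exists>U. openin T U \<and> x \<in> U \<and> U \<subseteq> {x \<in> E. l x < a}" if "x \<in> E" "l x < a" for x
    proof -
      obtain U where U: "openin T U" "x \<in> U" "\<forall>y\<in>U. \<bar>l y - l x\<bar> < a - l x"
        using nbhd[of x "a - l x"] \<open>x \<in> E\<close> \<open>l x < a\<close> by auto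
      have "l y < a" if "y \<in> U" for y
        using U(3) that by fastforce
      then show ?thesis
        using U openin_subset[OF U(1)] topspace_lc by blast
    qed
    then show "openin T {x \<in> topspace T. l x < a}"
      by (subst openin_subopen) (auto simp: topspace_lc)
  qed
  then show ?thesis
    unfolding continuous_map_upper_lower_semicontinuous_lt by blast
qed

lemma convex_epigraph:
  assumes "subspace E" and conv: "convex_fun E \<phi>"
  shows "convex {(h, r). h \<in> E \<and> \<phi> h \<le> ereal r}"
proof (rule convexI)
  fix p q and u v :: real
  assume pq: "p \<in> {(h, r). h \<in> E \<and> \<phi> h \<le> ereal r}" "q \<in> {(h, r). h \<in> E \<and> \<phi> h \<le> ereal r}"
    and uv: "0 \<le> u" "0 \<le> v" "u + v = 1"
  obtain h r k s where p: "p = (h, r)" "h \<in> E" "\<phi> h \<le> ereal r" and q: "q = (k, s)" "k \<in> E" "\<phi> k \<le> ereal s"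
    using pq by auto
  have v: "v = 1 - u" using uv by simp
  have "u *\<^sub>R h + v *\<^sub>R k = (\<lambda>x. u * h x + (1 - u) * k x)"
    by (auto simp: v fun_eq_iff)
  then have "\<phi> (u *\<^sub>R h + v *\<^sub>R k) \<le> ereal u * \<phi> h + ereal (1 - u) * \<phi> k"
    using conv p q uv by (simp add: convex_fun_def)
  also have "\<dots> \<le> ereal u * ereal r + ereal (1 - u) * ereal s"
    using p q uv v by (intro add_mono ereal_mult_left_mono) auto
  also have "\<dots> = ereal (u * r + v * s)"
    by (simp add: v)
  finally show "u *\<^sub>R p + v *\<^sub>R q \<in> {(h, r). h \<in> E \<and> \<phi> h \<le> ereal r}"
    using p q assms(1) by (auto intro: subspace_add subspace_scale)
qed

text \<open>The constant \<open>N\<close> below dominates the growth of \<open>\<phi>\<close> at \<open>f\<close> against the gauge of \<open>W\<close>: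
  inside \<open>f + W\<close> this is lower semicontinuity at \<open>f\<close>, outside it follows from convexity
  and lower semicontinuity at a point of the effective domain.\<close>

lemma lsc_convex_affine_minorant:
  assumes conv: "convex_fun E \<phi>" and proper: "proper_fun E \<phi>" and lsc: "lsc_top T \<phi>"
    and f: "f \<in> E" and c: "ereal c < \<phi> f"
  shows "\<exists>l\<in>top_dual E T. \<forall>h\<in>E. ereal (c + l h - l f) \<le> \<phi> h"
proof -
  have sub: "subspace E" using f by (intro subspace_lc) auto
  obtain h1 where h1: "h1 \<in> E" "\<phi> h1 \<noteq> \<infinity>" and fin: "\<And>h. h \<in> E \<Longrightarrow> \<phi> h \<noteq> -\<infinity>"
    using proper by (auto simp: proper_fun_def)
  obtain m where m: "\<phi> h1 = ereal m"
    using h1 fin[of h1] by (cases "\<phi> h1") auto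
  define epi where "epi = {(h, r). h \<in> E \<and> \<phi> h \<le> ereal r}"
  have epi: "convex epi"
    unfolding epi_def by (rule convex_epigraph[OF sub conv])
  obtain U where U: "openin T U" "f \<in> U" "\<forall>h\<in>U. ereal c < \<phi> h"
    using lsc f c unfolding lsc_top_def topspace_lc by blast
  have "ereal (m - 1) < \<phi> h1"
    by (simp add: m)
  then obtain U1 where U1: "openin T U1" "h1 \<in> U1" "\<forall>h\<in>U1. ereal (m - 1) < \<phi> h"
    using lsc h1(1) unfolding lsc_top_def topspace_lc by blast
  obtain W0 where W0: "openin T W0" "convex W0" "0 \<in> W0" "\<forall>w\<in>W0. - w \<in> W0" "\<forall>w\<in>W0. f + w \<in> U"
    using ex_symmetric_convex_nbhd[OF U(1,2)] by blast
  obtain W1 where W1: "openin T W1" "convex W1" "0 \<in> W1" "\<forall>w\<in>W1. - w \<in> W1" "\<forall>w\<in>W1. h1 + w \<in> U1"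
    using ex_symmetric_convex_nbhd[OF U1(1,2)] by blast
  define W where "W = W0 \<inter> W1"
  have W: "openin T W" "convex W" "0 \<in> W" "\<And>w. w \<in> W \<Longrightarrow> - w \<in> W"
    using W0 W1 by (auto simp: W_def intro: convex_Int)
  have WE: "W \<subseteq> E" using openin_subset[OF W(1)] topspace_lc by auto
  have above_f: "c < q" if "w \<in> W" "(f + w, q) \<in> epi" for w q
  proof -
    have "ereal c < \<phi> (f + w)" using U(3) W0(5) that(1) by (simp add: W_def)
    also have "\<dots> \<le> ereal q" using that(2) by (simp add: epi_def)
    finally show ?thesis by simp
  qed
  have above_h1: "m - 1 < q" if "w \<in> W" "(h1 + w, q) \<in> epi" for w q
  proof -
    have "ereal (m - 1) < \<phi> (h1 + w)" using U1(3) W1(5) that(1) by (simp add: W_def)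
    also have "\<dots> \<le> ereal q" using that(2) by (simp add: epi_def)
    finally show ?thesis by simp
  qed
  \<comment> \<open>\<open>\<rho>\<close> bounds the distance from \<open>h1\<close> to
    \<open>f\<close> in the gauge of \<open>W\<close>; a point \<open>f + r *\<^sub>R w\<close> then
    lies in \<open>h1 + (\<rho> + r) *\<^sub>R W\<close>.\<close>
  obtain \<rho> w1 where \<rho>: "\<rho> > 0" "w1 \<in> W" "f - h1 = \<rho> *\<^sub>R w1"
    using nbhd_absorbing[OF W(1,3), of "f - h1"] subspace_diff[OF sub f h1(1)] by blast
  \<comment> \<open>For \<open>r > 1\<close> convexity will give
    \<open>m - (\<rho> + r) < q\<close>, so \<open>growth\<close> needs
    \<open>c - m + \<rho> \<le> (N - 1) * r\<close>.\<close>
  define N where "N = 1 + \<bar>c - m + \<rho>\<bar>"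
  have N: "N \<ge> 1" by (simp add: N_def)
  have growth: "c - N * r \<le> q" if w: "w \<in> W" and r: "0 \<le> r" and q: "(f + r *\<^sub>R w, q) \<in> epi" for w r q
  proof (cases "r \<le> 1")
    case True
    have "r *\<^sub>R w + (1 - r) *\<^sub>R 0 \<in> W"
      using True r w W by (intro convexD) auto
    then have "c < q" using above_f[of "r *\<^sub>R w" q] q by simp
    moreover have "0 \<le> N * r" using N r by simp
    ultimately show ?thesis by linarith
  next
    case False
    define R where "R = \<rho> + r"
    have R: "R > 1" "R > 0" using False \<rho>(1) by (auto simp: R_def)
    define w' where "w' = (\<rho> / R) *\<^sub>R w1 + (r / R) *\<^sub>R w"
    have "\<rho> / R + r / R = 1"
      using R by (simp add: R_def add_divide_distrib[symmetric])
    then have w': "w' \<in> W"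
      unfolding w'_def using R \<rho> r w by (intro convexD[OF W(2)]) auto
    have "R *\<^sub>R w' = (f - h1) + r *\<^sub>R w"
      using R by (simp add: w'_def \<rho>(3) scaleR_add_right)
    then have "f + r *\<^sub>R w = h1 + R *\<^sub>R w'" by simp
    \<comment> \<open>Weight \<open>1 / R\<close> pulls the distant point back into
      \<open>h1 + W\<close>, where \<open>\<phi>\<close> exceeds \<open>m - 1\<close>.\<close>
    then have "(1 - 1 / R) *\<^sub>R (h1, m) + (1 / R) *\<^sub>R (h1 + R *\<^sub>R w', q) \<in> epi"
      using q R h1(1) m by (intro convexD[OF epi]) (auto simp: epi_def)
    moreover have "(1 - 1 / R) *\<^sub>R h1 + (1 / R) *\<^sub>R (h1 + R *\<^sub>R w') = h1 + w'"
      using R by (simp add: algebra_simps)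
    ultimately have "(h1 + w', (1 - 1 / R) * m + (1 / R) * q) \<in> epi"
      by simp
    from above_h1[OF w' this] have "m - R < q"
      using R by (simp add: field_simps)
    moreover have "c - m + \<rho> \<le> \<bar>c - m + \<rho>\<bar> * r"
    proof -
      have "c - m + \<rho> \<le> \<bar>c - m + \<rho>\<bar>"
        by (rule abs_ge_self)
      also have "\<dots> \<le> \<bar>c - m + \<rho>\<bar> * r"
        using mult_left_mono[of 1 r "\<bar>c - m + \<rho>\<bar>"] False by simp
      finally show ?thesis .
    qed
    ultimately show ?thesis
      by (simp add: N_def R_def algebra_simps)
  qed
  \<comment> \<open>Majorisation on the cone over \<open>A\<close> says
    \<open>l (h - f) \<le> q - c\<close> on the epigraph, the minorant inequality; on the cone over
    \<open>B\<close> it says \<open>l \<le> N\<close> on \<open>W\<close>, which gives continuity.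
    \<open>growth\<close> is the compatibility of the two.\<close>
  define A where "A = (\<lambda>p. p - (f, c)) ` epi"
  define B where "B = W \<times> {N}"
  define G where "G = (\<Union>a\<in>conic hull A. \<Union>b\<in>conic hull B. {a + b})"
  have "(h1, m) \<in> epi" using h1 m by (simp add: epi_def)
  then have ne: "A \<noteq> {}" "B \<noteq> {}" using W(3) by (auto simp: A_def B_def)
  have "convex A" unfolding A_def
    using convex_translation_subtract[OF epi] by simp
  moreover have "convex B"
    unfolding B_def using W(2) by (intro convex_Times) auto
  ultimately have cones: "convex_cone (conic hull A)" "convex_cone (conic hull B)"
    using ne by (auto simp: convex_cone_def conic_conic_hull convex_conic_hull conic_hull_eq_empty)
  have G: "convex_cone G"
    unfolding G_def by (rule convex_cone_sums[OF cones])
  have G_iff: "(x, r) \<in> G \<longleftrightarrow> (\<exists>t h q s w. 0 \<le> t \<and> (h, q) \<in> epi \<and> 0 \<le> s \<and> w \<in> W \<and>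
      x = t *\<^sub>R (h - f) + s *\<^sub>R w \<and> r = t * (q - c) + s * N)" for x r
  proof
    assume "(x, r) \<in> G"
    then obtain t p s w where "0 \<le> t" "p \<in> epi" "0 \<le> s" "w \<in> W"
      "(x, r) = t *\<^sub>R (p - (f, c)) + s *\<^sub>R (w, N)"
      by (auto simp: G_def conic_hull_explicit A_def B_def)
    then show "\<exists>t h q s w. 0 \<le> t \<and> (h, q) \<in> epi \<and> 0 \<le> s \<and> w \<in> W \<and>
      x = t *\<^sub>R (h - f) + s *\<^sub>R w \<and> r = t * (q - c) + s * N"
      by (intro exI[of _ t] exI[of _ "fst p"] exI[of _ "snd p"] exI[of _ s] exI[of _ w])
        (cases p, auto)
  next
    assume "\<exists>t h q s w. 0 \<le> t \<and> (h, q) \<in> epi \<and> 0 \<le> s \<and> w \<in> W \<and>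
      x = t *\<^sub>R (h - f) + s *\<^sub>R w \<and> r = t * (q - c) + s * N"
    then obtain t h q s w where *: "0 \<le> t" "(h, q) \<in> epi" "0 \<le> s" "w \<in> W"
      "x = t *\<^sub>R (h - f) + s *\<^sub>R w" "r = t * (q - c) + s * N" by blast
    have "(h, q) - (f, c) \<in> A" "(w, N) \<in> B"
      using * unfolding A_def B_def by blast+
    then have "t *\<^sub>R ((h, q) - (f, c)) \<in> conic hull A" "s *\<^sub>R (w, N) \<in> conic hull B"
      using * unfolding conic_hull_explicit by blast+
    moreover have "(x, r) = t *\<^sub>R ((h, q) - (f, c)) + s *\<^sub>R (w, N)"
      using * by simp
    ultimately show "(x, r) \<in> G"
      unfolding G_def by blast
  qed
  have "\<exists>l. (\<forall>x\<in>E. \<forall>y\<in>E. \<forall>a b. l (a *\<^sub>R x + b *\<^sub>R y) = a * l x + b * l y)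
           \<and> (\<forall>x r. (x, r) \<in> G \<longrightarrow> l x \<le> r)"
  proof (rule convex_cone_majorizes_linear[OF sub G])
    show "G \<subseteq> E \<times> UNIV"
    proof
      fix p assume p: "p \<in> G"
      obtain x r where xr: "p = (x, r)" by (cases p)
      obtain t h q s w where "(h, q) \<in> epi" "w \<in> W" "x = t *\<^sub>R (h - f) + s *\<^sub>R w"
        using p unfolding xr G_iff by blast
      moreover from this have "h \<in> E" "w \<in> E" using WE by (auto simp: epi_def)
      ultimately show "p \<in> E \<times> UNIV"
        using sub f by (auto simp: xr intro!: subspace_add subspace_scale subspace_diff)
    qed
    show "\<exists>r. (x, r) \<in> G" if x: "x \<in> E" for x
    proof -
      obtain s w where "s > 0" "w \<in> W" "x = s *\<^sub>R w"
        using nbhd_absorbing[OF W(1,3) x] by blast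
      then have "(x, s * N) \<in> G"
        unfolding G_iff using \<open>(h1, m) \<in> epi\<close>
        by (intro exI[of _ 0] exI[of _ h1] exI[of _ m] exI[of _ s] exI[of _ w]) auto
      then show ?thesis by blast
    qed
    show "0 \<le> r" if r: "(0, r) \<in> G" for r
    proof -
      obtain t h q s w where *: "0 \<le> t" "(h, q) \<in> epi" "0 \<le> s" "w \<in> W"
        "0 = t *\<^sub>R (h - f) + s *\<^sub>R w" "r = t * (q - c) + s * N"
        using r unfolding G_iff by blast
      show ?thesis
      proof (cases "t = 0")
        case True
        then show ?thesis using * N by simp
      next
        case False
        then have t: "t > 0" using * by simp
        \<comment> \<open>Dividing by \<open>t\<close> exhibits \<open>h\<close> as
          \<open>f + (s / t) *\<^sub>R (- w)\<close>, the form to which \<open>growth\<close>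
          applies.\<close>
        have "t *\<^sub>R (h - f) = s *\<^sub>R (- w)"
          using *(5) by (simp add: eq_neg_iff_add_eq_0)
        then have "(1 / t) *\<^sub>R (t *\<^sub>R (h - f)) = (1 / t) *\<^sub>R (s *\<^sub>R (- w))"
          by simp
        then have "h - f = (s / t) *\<^sub>R (- w)"
          using t by simp
        then have "h = f + (s / t) *\<^sub>R (- w)"
          by (simp add: diff_eq_eq add.commute)
        then have "c - N * (s / t) \<le> q"
          using growth[of "- w" "s / t" q] W(4)[OF *(4)] *(2,3) t by simp
        then show ?thesis
          using t *(6) by (simp add: field_simps)
      qed
    qed
  qed
  then obtain l where lin: "\<And>x y a b. x \<in> E \<Longrightarrow> y \<in> E \<Longrightarrow> l (a *\<^sub>R x + b *\<^sub>R y) = a * l x + b * l y"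
    and le: "\<And>x r. (x, r) \<in> G \<Longrightarrow> l x \<le> r" by blast
  have lW: "l w \<le> N" if "w \<in> W" for w
  proof (rule le)
    show "(w, N) \<in> G"
      unfolding G_iff using \<open>(h1, m) \<in> epi\<close> that
      by (intro exI[of _ 0] exI[of _ h1] exI[of _ m] exI[of _ 1] exI[of _ w]) auto
  qed
  have "\<bar>l w\<bar> \<le> N" if "w \<in> W" for w
  proof -
    have "l (- w) = - l w"
      using lin[of w w "- 1" 0] that WE by auto
    then show ?thesis using lW[OF that] lW[OF W(4)[OF that]] by linarith
  qed
  then have "continuous_map T euclideanreal l"
    by (rule continuous_map_bounded_linear[OF W(1,3) _ lin])
  then have "l \<in> top_dual E T"
    using lin by (simp add: top_dual_iff)
  moreover have "ereal (c + l h - l f) \<le> \<phi> h" if h: "h \<in> E" for h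
  proof (cases "\<phi> h")
    case (real q)
    have "(h - f, q - c) \<in> G"
      unfolding G_iff using h real W(3)
      by (intro exI[of _ 1] exI[of _ h] exI[of _ q] exI[of _ 0] exI[of _ 0]) (auto simp: epi_def)
    from le[OF this] have "l (h - f) \<le> q - c" .
    moreover have "l (h - f) = l h - l f"
      using lin[OF h f, of 1 "- 1"] by simp
    ultimately show ?thesis by (simp add: real)
  qed (use fin[OF h] in auto)
  ultimately show ?thesis by blast
qed

end

section \<open>Minimisation over sets closed in probability\<close>

text \<open>The function \<open>jap\<close> is a strictly convex substitute for the absolute value
  and \<open>jap'\<close> is its derivative, which takes values in \<open>(- 1, 1)\<close>.\<close>

definition jap :: "real \<Rightarrow> real"
  where "jap x = sqrt (1 + x\<^sup>2)"

definition jap' :: "real \<Rightarrow> real"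
  where "jap' x = x / jap x"

lemma jap_ge_1: "1 \<le> jap x"
  by (simp add: jap_def)

lemma jap_pos: "0 < jap x"
  using jap_ge_1[of x] by linarith

lemma jap_square: "(jap x)\<^sup>2 = 1 + x\<^sup>2"
  by (simp add: jap_def)

lemma jap_le: "jap x \<le> 1 + \<bar>x\<bar>"
  unfolding jap_def by (rule real_le_lsqrt) (auto simp: power2_eq_square algebra_simps)

lemma abs_jap'_le: "\<bar>jap' x\<bar> \<le> 1"
proof -
  have "\<bar>x\<bar> \<le> jap x"
    unfolding jap_def by (rule real_le_rsqrt) simp
  then show ?thesis
    using jap_pos[of x] by (simp add: jap'_def abs_div)
qed

lemma one_minus_jap'_square: "1 - (jap' x)\<^sup>2 = 1 / (jap x)\<^sup>2"
proof -
  have "1 + x\<^sup>2 > 0"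
    by (simp add: add_pos_nonneg)
  then show ?thesis
    by (simp add: jap'_def power_divide jap_square field_simps)
qed

lemma jap_eq: "jap x = 1 / sqrt (1 - (jap' x)\<^sup>2)"
  using jap_pos[of x] by (simp add: one_minus_jap'_square real_sqrt_divide)

text \<open>An explicit inverse of \<open>jap'\<close>, continuous on the open interval from
  \<open>- 1\<close> to \<open>1\<close>: pointwise limits of \<open>jap'\<close> values there yield
  limits of the arguments.\<close>

lemma jap'_inverse: "jap' x / sqrt (1 - (jap' x)\<^sup>2) = x"
proof -
  have "jap' x / sqrt (1 - (jap' x)\<^sup>2) = jap' x * jap x"
    using jap_eq[of x] by simp
  also have "\<dots> = x"
    using jap_pos[of x] by (simp add: jap'_def)
  finally show ?thesis .
qed

text \<open>Cauchy-Schwarz for the plane vectors \<open>(1, x)\<close> and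
  \<open>(1, y)\<close>.\<close>

lemma jap_mult_ge: "1 + x * y \<le> jap x * jap y"
proof -
  have "(1 + x\<^sup>2) * (1 + y\<^sup>2) - (1 + x * y)\<^sup>2 = (x - y)\<^sup>2"
    by (simp add: power2_eq_square algebra_simps)
  then have "(1 + x * y)\<^sup>2 \<le> (1 + x\<^sup>2) * (1 + y\<^sup>2)"
    using zero_le_power2[of "x - y"] by linarith
  then have "1 + x * y \<le> sqrt ((1 + x\<^sup>2) * (1 + y\<^sup>2))"
    by (rule real_le_rsqrt)
  then show ?thesis by (simp add: jap_def real_sqrt_mult)
qed

text \<open>The tangent at \<open>y\<close> lies below the graph. With it a first-order condition
  needs no differentiation under the integral.\<close>

lemma jap_diff_le: "jap y - jap x \<le> jap' y * (y - x)"
proof -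
  have "jap y * (jap y - jap x) \<le> y * (y - x)"
    using jap_mult_ge[of x y] jap_square[of y] by (simp add: power2_eq_square algebra_simps)
  then show ?thesis
    using jap_pos[of y] by (simp add: jap'_def field_simps)
qed

text \<open>With \<open>u = (1, a)\<close> and \<open>v = (1, b)\<close> in the plane the right-hand side is
  \<open>\<bar>u\<bar> + \<bar>v\<bar> - \<bar>u + v\<bar>\<close>, and \<open>jap' a\<close>, \<open>jap' b\<close> are the second coordinates of the normalised vectors.\<close>

lemma jap_uniformly_convex:
  "(jap' a - jap' b)\<^sup>2 / 4 \<le> jap a + jap b - 2 * jap ((a + b) / 2)"
proof -
  define u v w D where "u = jap a" and "v = jap b" and "w = 2 * jap ((a + b) / 2)"
    and "D = u * v - 1 - a * b"
  have u: "u \<ge> 1" and v: "v \<ge> 1" and w: "w > 0"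
    using jap_ge_1 jap_pos[of "(a + b) / 2"] by (auto simp: u_def v_def w_def)
  have u2: "u * u = 1 + a * a" and v2: "v * v = 1 + b * b"
    using jap_square[of a] jap_square[of b] by (auto simp: u_def v_def power2_eq_square)
  have w2: "w * w = 4 + (a + b) * (a + b)"
    using jap_square[of "(a + b) / 2"] by (simp add: w_def power2_eq_square field_simps)
  have D: "D \<ge> 0"
    using jap_mult_ge[of a b] by (simp add: D_def u_def v_def)
  \<comment> \<open>\<open>D\<close> is the Cauchy-Schwarz defect, and
    \<open>(u + v)\<^sup>2 - w\<^sup>2\<close> is twice it.\<close>
  have diff: "(u + v - w) * (u + v + w) = 2 * D"
    using u2 v2 w2 by (simp add: D_def algebra_simps)
  have "0 \<le> u + v - w"
    using diff D u v w by (smt (verit) mult_neg_pos)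
  then have "(u + v - w) * (u + v + w) \<le> (u + v - w) * (2 * (u + v))"
    by (intro mult_left_mono) auto
  then have 1: "D / (u + v) \<le> u + v - w"
    using diff u v by (simp add: field_simps)
  have "0 \<le> (u - 1) * v + (v - 1) * u"
    using u v by (intro add_nonneg_nonneg mult_nonneg_nonneg) auto
  then have 2: "D / (2 * (u * v)) \<le> D / (u + v)"
    using u v D by (intro divide_left_mono mult_pos_pos) (auto simp: algebra_simps)
  \<comment> \<open>The squared distance of the two normalised vectors; the first coordinates are
    discarded afterwards.\<close>
  have "(a / u - b / v)\<^sup>2 + (1 / u - 1 / v)\<^sup>2 = (a * a + 1) / (u * u) + (b * b + 1) / (v * v) - 2 * (1 + a * b) / (u * v)"
    using u v by (simp add: power2_eq_square field_simps)
  also have "\<dots> = 2 * D / (u * v)"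
    using u v by (simp add: u2[symmetric] v2[symmetric] add.commute D_def field_simps)
  finally have "(a / u - b / v)\<^sup>2 \<le> 2 * D / (u * v)"
    using zero_le_power2[of "1 / u - 1 / v"] by linarith
  then have "(a / u - b / v)\<^sup>2 / 4 \<le> D / (2 * (u * v))"
    using u v by (simp add: field_simps)
  with 1 2 have "(a / u - b / v)\<^sup>2 / 4 \<le> u + v - w" by linarith
  then show ?thesis by (simp add: u_def v_def w_def jap'_def)
qed

lemma jap_measurable [measurable]: "jap \<in> borel_measurable borel"
  unfolding jap_def by measurable

lemma jap'_measurable [measurable]: "jap' \<in> borel_measurable borel"
  unfolding jap'_def by measurable

lemma continuous_on_jap: "continuous_on UNIV jap"
  unfolding jap_def by (intro continuous_intros)

lemma continuous_on_jap': "continuous_on UNIV jap'"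
  unfolding jap'_def using jap_pos
  by (intro continuous_intros continuous_on_jap) (metis less_irrefl)

section \<open>Convergence in probability and almost everywhere\<close>

context finite_measure
begin

lemma AE_tendsto_imp_conv_in_prob:
  assumes [measurable]: "\<And>n. fs n \<in> borel_measurable M" "f \<in> borel_measurable M"
    and lim: "AE x in M. (\<lambda>n. fs n x) \<longlonglongrightarrow> f x"
  shows "conv_in_prob M fs f"
  unfolding conv_in_prob_def
proof (intro allI impI)
  fix e :: real assume e: "e > 0"
  define A where "A n = {x \<in> space M. e < \<bar>fs n x - f x\<bar>}" for n
  have [measurable]: "A n \<in> sets M" for n unfolding A_def by measurable
  have "(\<lambda>n. \<integral>x. indicator (A n) x \<partial>M) \<longlonglongrightarrow> (\<integral>x. (0::real) \<partial>M)"
  proof (rule integral_dominated_convergence[where w="\<lambda>_. 1"])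
    show "AE x in M. (\<lambda>n. indicat_real (A n) x) \<longlonglongrightarrow> 0"
      using lim
    proof eventually_elim
      case (elim x)
      then have "eventually (\<lambda>n. dist (fs n x) (f x) < e) sequentially"
        using e by (rule tendstoD)
      then have "eventually (\<lambda>n. indicat_real (A n) x = 0) sequentially"
        by eventually_elim (auto simp: A_def dist_real_def indicator_def)
      then show ?case by (rule tendsto_eventually)
    qed
  qed (auto simp: indicator_def)
  then show "(\<lambda>n. measure M {x \<in> space M. e < \<bar>fs n x - f x\<bar>}) \<longlonglongrightarrow> 0"
    unfolding A_def[symmetric] by simp
qed

text \<open>Truncating the distance at 1 turns convergence in probability into convergence in mean,
  for which an almost everywhere convergent subsequence exists.\<close>

lemma conv_in_prob_imp_AE_subseq:
  assumes [measurable]: "\<And>n. fs n \<in> borel_measurable M" "f \<in> borel_measurable M"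
    and lim: "conv_in_prob M fs f"
  shows "\<exists>r. strict_mono r \<and> (AE x in M. (\<lambda>n. fs (r n) x) \<longlonglongrightarrow> f x)"
proof -
  define u where "u n x = min 1 \<bar>fs n x - f x\<bar>" for n x
  have [measurable]: "u n \<in> borel_measurable M" for n unfolding u_def by measurable
  have int: "integrable M (u n)" for n
    by (rule integrable_const_bound[where B=1]) (auto simp: u_def)
  have "(\<lambda>n. \<integral>x. norm (u n x) \<partial>M) \<longlonglongrightarrow> 0"
  proof (rule LIMSEQ_I)
    fix e :: real assume e: "e > 0"
    define d where "d = e / (2 * (measure M (space M) + 1))"
    have "0 < measure M (space M) + 1"
      using measure_nonneg[of M "space M"] by linarith
    then have d: "d > 0" and dM: "d * measure M (space M) \<le> e / 2"
      using e by (auto simp: d_def field_simps)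
    have "eventually (\<lambda>n. dist (measure M {x \<in> space M. d < \<bar>fs n x - f x\<bar>}) 0 < e / 2) sequentially"
      using lim d e unfolding conv_in_prob_def by (intro tendstoD) auto
    then obtain N where N: "\<And>n. n \<ge> N \<Longrightarrow> measure M {x \<in> space M. d < \<bar>fs n x - f x\<bar>} < e / 2"
      by (auto simp: eventually_sequentially)
    have "norm ((\<integral>x. norm (u n x) \<partial>M) - 0) < e" if "n \<ge> N" for n
    proof -
      define A where "A = {x \<in> space M. d < \<bar>fs n x - f x\<bar>}"
      have [measurable]: "A \<in> sets M" unfolding A_def by measurable
      have [simp]: "integrable M (indicat_real A)"
        by (rule integrable_const_bound[where B=1]) auto
      have "(\<integral>x. norm (u n x) \<partial>M) \<le> (\<integral>x. d + indicator A x \<partial>M)"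
      proof (rule integral_mono)
        show "integrable M (\<lambda>x. d + indicat_real A x)"
          by (intro Bochner_Integration.integrable_add) auto
        show "integrable M (\<lambda>x. norm (u n x))"
          by (intro integrable_norm int)
        show "norm (u n x) \<le> d + indicat_real A x" if "x \<in> space M" for x
          using d that by (auto simp: u_def A_def indicator_def)
      qed
      also have "\<dots> = d * measure M (space M) + measure M A"
        by (subst Bochner_Integration.integral_add) simp_all
      also have "\<dots> < e"
        using dM N[OF that] by (simp add: A_def)
      finally show ?thesis
        by (simp add: u_def)
    qed
    then show "\<exists>no. \<forall>n\<ge>no. norm ((\<integral>x. norm (u n x) \<partial>M) - 0) < e" by blast
  qed
  from tendsto_L1_AE_subseq[OF int this]
  obtain r where r: "strict_mono r" "AE x in M. (\<lambda>n. u (r n) x) \<longlonglongrightarrow> 0" by blast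
  from r(2) have "AE x in M. (\<lambda>n. fs (r n) x) \<longlonglongrightarrow> f x"
  proof eventually_elim
    case (elim x)
    show ?case
    proof (rule tendstoI)
      fix e :: real assume e: "e > 0"
      have "eventually (\<lambda>n. dist (u (r n) x) 0 < min e 1) sequentially"
        using elim by (rule tendstoD) (use e in auto)
      then show "eventually (\<lambda>n. dist (fs (r n) x) (f x) < e) sequentially"
        by eventually_elim (auto simp: u_def dist_real_def split: if_splits)
    qed
  qed
  with r(1) show ?thesis by blast
qed

end

text \<open>Decay like \<open>(1 / 4) ^ n\<close> leaves room for a factor \<open>2 ^ n\<close>: the
  sum of the weighted squares remains integrable, hence finite almost everywhere. The inequality
  \<open>d \<le> 2 ^ n * d\<^sup>2 + (1 / 2) ^ n\<close> then makes the increments themselves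
  absolutely summable.\<close>

lemma AE_convergent_of_L2_increments:
  fixes h :: "nat \<Rightarrow> 'a \<Rightarrow> real"
  assumes [measurable]: "\<And>n. h n \<in> borel_measurable M" "w \<in> borel_measurable M"
    and w: "AE x in M. 0 < w x"
    and int: "\<And>n. integrable M (\<lambda>x. (h n x - h (Suc n) x)\<^sup>2 * w x)"
    and bound: "\<And>n. (\<integral>x. (h n x - h (Suc n) x)\<^sup>2 * w x \<partial>M) \<le> B * (1 / 4) ^ n"
  shows "AE x in M. convergent (\<lambda>n. h n x)"
proof -
  define g where "g n x = 2 ^ n * ((h n x - h (Suc n) x)\<^sup>2 * w x)" for n x
  have [measurable]: "g n \<in> borel_measurable M" for n unfolding g_def by measurable
  have g_nonneg: "AE x in M. \<forall>n. 0 \<le> g n x"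
    using w by eventually_elim (auto simp: g_def)
  have g_int: "(\<integral>\<^sup>+x. ennreal (g n x) \<partial>M) \<le> ennreal (B * (1 / 2) ^ n)" for n
  proof -
    have "(\<integral>\<^sup>+x. ennreal (g n x) \<partial>M) = ennreal (\<integral>x. g n x \<partial>M)"
      using g_nonneg int[of n] by (intro nn_integral_eq_integral) (auto simp: g_def)
    also have "(\<integral>x. g n x \<partial>M) = 2 ^ n * (\<integral>x. (h n x - h (Suc n) x)\<^sup>2 * w x \<partial>M)"
      unfolding g_def by simp
    also have "ennreal \<dots> \<le> ennreal (2 ^ n * (B * (1 / 4) ^ n))"
      using bound[of n] by (intro ennreal_leI mult_left_mono) auto
    also have "(2::real) ^ n * (B * (1 / 4) ^ n) = B * (2 * (1 / 4)) ^ n"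
      by (simp only: power_mult_distrib) simp
    finally show ?thesis by simp
  qed
  have "0 \<le> (\<integral>x. (h 0 x - h (Suc 0) x)\<^sup>2 * w x \<partial>M)"
    using w by (intro integral_nonneg_AE) (auto elim: eventually_mono)
  then have B: "0 \<le> B" using bound[of 0] by simp
  have "(\<integral>\<^sup>+x. (\<Sum>n. ennreal (g n x)) \<partial>M) = (\<Sum>n. \<integral>\<^sup>+x. ennreal (g n x) \<partial>M)"
    by (rule nn_integral_suminf) measurable
  also have "\<dots> \<le> (\<Sum>n. ennreal (B * (1 / 2) ^ n))"
    by (intro suminf_le g_int) auto
  also have "\<dots> = ennreal (\<Sum>n. B * (1 / 2) ^ n)"
    using B by (intro suminf_ennreal2) (auto intro!: summable_mult summable_geometric)
  finally have "(\<integral>\<^sup>+x. (\<Sum>n. ennreal (g n x)) \<partial>M) \<noteq> \<infinity>"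
    by (auto simp: top_unique)
  then have "AE x in M. (\<Sum>n. ennreal (g n x)) \<noteq> \<infinity>"
    by (intro nn_integral_PInf_AE) auto
  with g_nonneg w show ?thesis
  proof eventually_elim
    case (elim x)
    then have "0 < w x" by simp
    have "summable (\<lambda>n. g n x)"
      using elim by (intro summable_suminf_not_top) auto
    then have "summable (\<lambda>n. g n x * (1 / w x))"
      by (rule summable_mult2)
    then have "summable (\<lambda>n. g n x * (1 / w x) + (1 / 2) ^ n)"
      by (intro summable_add) (auto intro: summable_geometric)
    then have "summable (\<lambda>n. h n x - h (Suc n) x)"
    proof (rule summable_comparison_test')
      fix n :: nat
      define d where "d = \<bar>h n x - h (Suc n) x\<bar>"
      have "d \<le> 2 ^ n * d\<^sup>2 + (1 / 2) ^ n"
      proof -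
        have "0 \<le> (2 ^ n * d - 1)\<^sup>2 + 2 ^ n * d"
          by (simp add: d_def)
        then have "2 ^ n * d \<le> (2 ^ n * d)\<^sup>2 + 1"
          by (simp add: power2_eq_square algebra_simps)
        also have "\<dots> = 2 ^ n * (2 ^ n * d\<^sup>2 + (1 / 2) ^ n)"
          by (simp add: power2_eq_square algebra_simps power_one_over)
        finally show ?thesis by simp
      qed
      then show "norm (h n x - h (Suc n) x) \<le> g n x * (1 / w x) + (1 / 2) ^ n"
        using \<open>0 < w x\<close> by (simp add: d_def g_def)
    qed
    then have "summable (\<lambda>n. - (h n x - h (Suc n) x))"
      by (rule summable_minus)
    then have "summable (\<lambda>n. h (Suc n) x - h n x)"
      by simp
    then have "(\<lambda>n. h n x - h 0 x) \<longlonglongrightarrow> (\<Sum>n. h (Suc n) x - h n x)"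
      using summable_LIMSEQ[of "\<lambda>n. h (Suc n) x - h n x"] by (simp add: sum_lessThan_telescope[of "\<lambda>n. h n x"])
    from tendsto_add[OF this tendsto_const[of "h 0 x"]] show ?case
      by (auto simp: convergent_def)
  qed
qed

lemma integrable_jap:
  assumes [measurable]: "f \<in> borel_measurable M" "f0 \<in> borel_measurable M" "w \<in> borel_measurable M"
    and w: "AE x in M. 0 < w x" and w_int: "integrable M w"
    and int: "integrable M (\<lambda>x. f x * w x)" "integrable M (\<lambda>x. f0 x * w x)"
  shows "integrable M (\<lambda>x. jap (f x - f0 x) * w x)"
proof (rule Bochner_Integration.integrable_bound)
  show "integrable M (\<lambda>x. w x + \<bar>f x * w x\<bar> + \<bar>f0 x * w x\<bar>)"
    using int w_int by (intro Bochner_Integration.integrable_add integrable_abs)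
  show "AE x in M. norm (jap (f x - f0 x) * w x) \<le> norm (w x + \<bar>f x * w x\<bar> + \<bar>f0 x * w x\<bar>)"
    using w
  proof eventually_elim
    case (elim x)
    have "jap (f x - f0 x) \<le> 1 + \<bar>f x\<bar> + \<bar>f0 x\<bar>"
      using jap_le[of "f x - f0 x"] by linarith
    then have "jap (f x - f0 x) * w x \<le> (1 + \<bar>f x\<bar> + \<bar>f0 x\<bar>) * w x"
      using elim by (intro mult_right_mono) auto
    then show ?case
      using elim jap_pos[of "f x - f0 x"] by (simp add: abs_mult algebra_simps)
  qed
qed measurable

text \<open>As \<open>1 - (jap' y)\<^sup>2 = 1 / (jap y)\<^sup>2\<close>, a limit of the
  \<open>jap'\<close> values outside the open interval would send \<open>jap (y n)\<close> to
  infinity, against \<open>fin\<close>. Inside it the inverse of \<open>jap'\<close> is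
  continuous.\<close>

lemma convergent_of_jap'_convergent:
  assumes "convergent (\<lambda>n. jap' (y n))" and w: "0 < w"
    and fin: "liminf (\<lambda>n. ennreal (jap (y n) * w)) \<noteq> \<infinity>"
  shows "convergent y"
proof -
  obtain h where h: "(\<lambda>n. jap' (y n)) \<longlonglongrightarrow> h"
    using assms(1) by (auto simp: convergent_def)
  have "0 < 1 - h\<^sup>2"
  proof (rule ccontr)
    assume neg: "\<not> 0 < 1 - h\<^sup>2"
    have "ennreal r \<le> liminf (\<lambda>n. ennreal (jap (y n) * w))" for r
    proof (rule Liminf_bounded)
      define s where "s = max r 1"
      have s: "s > 0" "r \<le> s" by (auto simp: s_def)
      have "(\<lambda>n. 1 - (jap' (y n))\<^sup>2) \<longlonglongrightarrow> 1 - h\<^sup>2"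
        by (intro tendsto_intros h)
      moreover have "1 - h\<^sup>2 < (w / s)\<^sup>2"
        using neg w s by (smt (verit) divide_pos_pos zero_less_power)
      ultimately have "eventually (\<lambda>n. 1 - (jap' (y n))\<^sup>2 < (w / s)\<^sup>2) sequentially"
        by (rule order_tendstoD(2))
      then show "eventually (\<lambda>n. ennreal r \<le> ennreal (jap (y n) * w)) sequentially"
      proof eventually_elim
        case (elim n)
        have "(1 / jap (y n))\<^sup>2 < (w / s)\<^sup>2"
          using elim by (simp add: one_minus_jap'_square power_divide)
        then have "1 / jap (y n) < w / s"
          by (rule power2_less_imp_less) (use w s in simp)
        then have "s < jap (y n) * w"
          using jap_pos[of "y n"] s by (simp add: field_simps)
        then show ?case
          using s by (intro ennreal_leI) simp
      qed
    qed
    note bound = this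
    show False
    proof (cases "liminf (\<lambda>n. ennreal (jap (y n) * w))" rule: ennreal_cases)
      case (real r)
      then show False using bound[of "r + 1"] by simp
    qed (use fin in simp)
  qed
  then have "(\<lambda>n. jap' (y n) / sqrt (1 - (jap' (y n))\<^sup>2)) \<longlonglongrightarrow> h / sqrt (1 - h\<^sup>2)"
    by (intro tendsto_intros h) auto
  then show ?thesis
    unfolding jap'_inverse by (auto simp: convergent_def)
qed

section \<open>Existence of a minimiser and its first-order condition\<close>

context finite_measure
begin

text \<open>By uniform convexity the images under \<open>jap'\<close> of a fast minimising sequence are Cauchy in
  weighted \<open>L\<^sup>2\<close>, hence converge almost everywhere, and Fatou's lemma keeps the limit of
  \<open>jap'\<close> away from \<open>1\<close> and \<open>- 1\<close>, where its inverse blows up.\<close>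

lemma ex_jap_minimiser:
  assumes conv: "convex_fset C" and closed: "closed_in_prob M C" and ne: "C \<noteq> {}"
    and [measurable]: "w \<in> borel_measurable M" "f0 \<in> borel_measurable M"
    and w: "AE x in M. 0 < w x" and w_int: "integrable M w"
    and int: "\<And>f. f \<in> C \<Longrightarrow> integrable M (\<lambda>x. f x * w x)" "integrable M (\<lambda>x. f0 x * w x)"
  shows "\<exists>f\<in>C. \<forall>g\<in>C. (\<integral>x. jap (f x - f0 x) * w x \<partial>M) \<le> (\<integral>x. jap (g x - f0 x) * w x \<partial>M)"
proof -
  define J where "J f = (\<integral>x. jap (f x - f0 x) * w x \<partial>M)" for f
  have [measurable]: "f \<in> borel_measurable M" if "f \<in> C" for f
    using closed that by (auto simp: closed_in_prob_def L0_def)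
  have w0: "AE x in M. 0 \<le> w x" using w by eventually_elim simp
  have J_int: "integrable M (\<lambda>x. jap (f x - f0 x) * w x)" if "f \<in> C" for f
    using that w w_int int by (intro integrable_jap) auto
  have J_nonneg: "0 \<le> J f" for f
    unfolding J_def using w0 jap_pos
    by (intro integral_nonneg_AE) (auto elim!: eventually_mono simp: less_imp_le)
  define I where "I = Inf (J ` C)"
  have I_le: "I \<le> J f" if "f \<in> C" for f
    unfolding I_def using that J_nonneg by (intro cInf_lower bdd_belowI[of _ 0]) auto
  \<comment> \<open>The rate is the one required by
    \<open>AE_convergent_of_L2_increments\<close>.\<close>
  have "\<exists>f\<in>C. J f < I + (1 / 4) ^ n" for n :: nat
    using cInf_lessD[of "J ` C" "I + (1 / 4) ^ n"] ne by (auto simp: I_def)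
  then obtain fs where fs: "\<And>n. fs n \<in> C" "\<And>n. J (fs n) < I + (1 / 4) ^ n"
    by metis
  note [measurable] = fs(1)
  define h where "h n x = jap' (fs n x - f0 x)" for n x
  have [measurable]: "h n \<in> borel_measurable M" for n
    unfolding h_def using fs(1)[of n] by measurable
  have h_le: "\<bar>h n x\<bar> \<le> 1" for n x
    by (simp add: h_def abs_jap'_le)
  have h_int: "integrable M (\<lambda>x. (h n x - h (Suc n) x)\<^sup>2 * w x)" for n
  proof (rule Bochner_Integration.integrable_bound)
    show "integrable M (\<lambda>x. 4 * w x)" using w_int by simp
    show "AE x in M. norm ((h n x - h (Suc n) x)\<^sup>2 * w x) \<le> norm (4 * w x)"
      using w0
    proof eventually_elim
      case (elim x)
      have "\<bar>h n x - h (Suc n) x\<bar> \<le> 2"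
        using h_le[of n x] h_le[of "Suc n" x] by linarith
      then have "(h n x - h (Suc n) x)\<^sup>2 \<le> 2\<^sup>2"
        by (metis abs_le_square_iff abs_numeral)
      then show ?case using elim by (simp add: mult_right_mono)
    qed
  qed measurable
  have h_bound: "(\<integral>x. (h n x - h (Suc n) x)\<^sup>2 * w x \<partial>M) \<le> 8 * (1 / 4) ^ n" for n
  proof -
    \<comment> \<open>The midpoint stays in \<open>C\<close>, so \<open>J m\<close> is at least
      \<open>I\<close>, and uniform convexity bounds the increment by
      \<open>4 * (2 * (I + e) - 2 * I)\<close> with \<open>e = (1 / 4) ^ n\<close>.\<close>
    define m where "m x = (fs n x + fs (Suc n) x) / 2" for x
    have "(\<lambda>x. (1/2) * fs n x + (1 - 1/2) * fs (Suc n) x) \<in> C"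
      by (rule conv[unfolded convex_fset_def, rule_format]) (use fs(1) in auto)
    also have "(\<lambda>x. (1/2) * fs n x + (1 - 1/2) * fs (Suc n) x) = m"
      by (auto simp: m_def fun_eq_iff field_simps)
    finally have m: "m \<in> C" .
    have "(\<integral>x. (h n x - h (Suc n) x)\<^sup>2 * w x \<partial>M) \<le>
      (\<integral>x. 4 * (jap (fs n x - f0 x) * w x + jap (fs (Suc n) x - f0 x) * w x - 2 * (jap (m x - f0 x) * w x)) \<partial>M)"
    proof (rule integral_mono_AE)
      show "AE x in M. (h n x - h (Suc n) x)\<^sup>2 * w x \<le>
        4 * (jap (fs n x - f0 x) * w x + jap (fs (Suc n) x - f0 x) * w x - 2 * (jap (m x - f0 x) * w x))"
        using w0
      proof eventually_elim
        case (elim x)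
        have "(h n x - h (Suc n) x)\<^sup>2 / 4 \<le> jap (fs n x - f0 x) + jap (fs (Suc n) x - f0 x) - 2 * jap (m x - f0 x)"
          using jap_uniformly_convex[of "fs n x - f0 x" "fs (Suc n) x - f0 x"]
          by (simp add: h_def m_def field_simps)
        then have "(h n x - h (Suc n) x)\<^sup>2 / 4 * w x \<le> (jap (fs n x - f0 x) + jap (fs (Suc n) x - f0 x) - 2 * jap (m x - f0 x)) * w x"
          using elim by (rule mult_right_mono)
        then show ?case by (simp add: algebra_simps)
      qed
    qed (use h_int J_int fs(1) m in simp_all)
    also have "\<dots> = 4 * (J (fs n) + J (fs (Suc n)) - 2 * J m)"
      using J_int[OF fs(1)] J_int[OF m] by (simp add: J_def)
    also have "\<dots> \<le> 8 * (1 / 4) ^ n"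
    proof -
      define e :: real where "e = (1 / 4) ^ n"
      have "(1 / 4) ^ Suc n \<le> e" by (simp add: e_def)
      then have "J (fs (Suc n)) < I + e"
        using fs(2)[of "Suc n"] by linarith
      moreover have "J (fs n) < I + e"
        using fs(2)[of n] by (simp add: e_def)
      ultimately show ?thesis
        using I_le[OF m] unfolding e_def[symmetric] by (simp add: algebra_simps)
    qed
    finally show ?thesis .
  qed
  have h_conv: "AE x in M. convergent (\<lambda>n. h n x)"
    by (rule AE_convergent_of_L2_increments[OF _ _ w h_int h_bound]) auto
  have J_lim: "(\<lambda>n. ennreal (J (fs n))) \<longlonglongrightarrow> ennreal I"
  proof (rule tendsto_ennrealI, rule tendsto_sandwich)
    show "(\<lambda>n. I) \<longlonglongrightarrow> I" by simp
    have "(\<lambda>n. I + (1 / 4) ^ n) \<longlonglongrightarrow> I + 0"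
      by (intro tendsto_intros LIMSEQ_power_zero) auto
    then show "(\<lambda>n. I + (1 / 4) ^ n) \<longlonglongrightarrow> I" by simp
    show "eventually (\<lambda>n. J (fs n) \<le> I + (1 / 4) ^ n) sequentially"
      using fs(2) by (intro always_eventually allI less_imp_le)
  qed (use I_le fs(1) in \<open>auto intro!: always_eventually\<close>)
  have J_nn: "(\<integral>\<^sup>+x. ennreal (jap (f x - f0 x) * w x) \<partial>M) = ennreal (J f)" if "f \<in> C" for f
    unfolding J_def using J_int[OF that] w0 jap_pos
    by (intro nn_integral_eq_integral) (auto elim!: eventually_mono simp: less_imp_le)
  \<comment> \<open>Used twice: finiteness of the left side gives pointwise convergence, and the
    bound by \<open>I\<close> gives minimality of the limit.\<close>
  have "(\<integral>\<^sup>+x. liminf (\<lambda>n. ennreal (jap (fs n x - f0 x) * w x)) \<partial>M)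
      \<le> liminf (\<lambda>n. \<integral>\<^sup>+x. ennreal (jap (fs n x - f0 x) * w x) \<partial>M)"
    by (rule nn_integral_liminf) measurable
  also have "\<dots> = ennreal I"
    using J_nn[OF fs(1)] lim_imp_Liminf[OF _ J_lim] by simp
  finally have fatou: "(\<integral>\<^sup>+x. liminf (\<lambda>n. ennreal (jap (fs n x - f0 x) * w x)) \<partial>M) \<le> ennreal I" .
  then have "(\<integral>\<^sup>+x. liminf (\<lambda>n. ennreal (jap (fs n x - f0 x) * w x)) \<partial>M) \<noteq> \<infinity>"
    by (auto simp: top_unique)
  then have "AE x in M. liminf (\<lambda>n. ennreal (jap (fs n x - f0 x) * w x)) \<noteq> \<infinity>"
    by (intro nn_integral_PInf_AE) measurable
  with h_conv w have conv_AE: "AE x in M. convergent (\<lambda>n. fs n x)"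
  proof eventually_elim
    case (elim x)
    have "convergent (\<lambda>n. fs n x - f0 x)"
      using elim by (intro convergent_of_jap'_convergent[of "\<lambda>n. fs n x - f0 x" "w x"]) (auto simp: h_def)
    then have "convergent (\<lambda>n. (fs n x - f0 x) + f0 x)"
      by (intro convergent_add convergent_const)
    then show ?case by simp
  qed
  define f where "f x = lim (\<lambda>n. fs n x)" for x
  have [measurable]: "f \<in> borel_measurable M"
    unfolding f_def using fs(1) by measurable
  have lim: "AE x in M. (\<lambda>n. fs n x) \<longlonglongrightarrow> f x"
    using conv_AE by eventually_elim (simp add: f_def convergent_LIMSEQ_iff)
  have "conv_in_prob M fs f"
    using fs(1) lim by (intro AE_tendsto_imp_conv_in_prob) auto
  then have f: "f \<in> C"
    using closed fs(1) \<open>f \<in> borel_measurable M\<close> unfolding closed_in_prob_def L0_def by blast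
  have "ennreal (J f) = (\<integral>\<^sup>+x. ennreal (jap (f x - f0 x) * w x) \<partial>M)"
    using J_nn[OF f] by simp
  also have "\<dots> = (\<integral>\<^sup>+x. liminf (\<lambda>n. ennreal (jap (fs n x - f0 x) * w x)) \<partial>M)"
  proof (rule nn_integral_cong_AE)
    show "AE x in M. ennreal (jap (f x - f0 x) * w x) = liminf (\<lambda>n. ennreal (jap (fs n x - f0 x) * w x))"
      using lim
    proof eventually_elim
      case (elim x)
      have "(\<lambda>n. jap (fs n x - f0 x)) \<longlonglongrightarrow> jap (f x - f0 x)"
        by (intro continuous_on_tendsto_compose[OF continuous_on_jap] tendsto_intros elim) auto
      then have "(\<lambda>n. ennreal (jap (fs n x - f0 x) * w x)) \<longlonglongrightarrow> ennreal (jap (f x - f0 x) * w x)"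
        by (intro tendsto_ennrealI tendsto_intros)
      then show ?case by (intro lim_imp_Liminf[symmetric]) auto
    qed
  qed
  also have "\<dots> \<le> ennreal I" by (rule fatou)
  finally have "J f \<le> I"
    using I_def J_nonneg ne by (subst (asm) ennreal_le_iff) (auto intro!: cInf_greatest)
  then show ?thesis
    using f I_le order_trans unfolding J_def by blast
qed

text \<open>Moving from \<open>f\<close> towards \<open>g\<close> by \<open>t n\<close> cannot
  decrease the integral, so the tangent inequality at the moved point \<open>k n\<close> gives a
  nonnegative integral for each \<open>n\<close>. Boundedness of \<open>jap'\<close> supplies the
  dominating function for \<open>t n\<close> tending to 0.\<close>

lemma jap_minimiser_variational:
  assumes conv: "convex_fset C" and f: "f \<in> C" and g: "g \<in> C"
    and meas: "C \<subseteq> borel_measurable M"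
    and [measurable]: "w \<in> borel_measurable M" "f0 \<in> borel_measurable M"
    and w: "AE x in M. 0 < w x" and w_int: "integrable M w"
    and int: "\<And>f. f \<in> C \<Longrightarrow> integrable M (\<lambda>x. f x * w x)" "integrable M (\<lambda>x. f0 x * w x)"
    and mini: "\<And>g. g \<in> C \<Longrightarrow> (\<integral>x. jap (f x - f0 x) * w x \<partial>M) \<le> (\<integral>x. jap (g x - f0 x) * w x \<partial>M)"
  shows "0 \<le> (\<integral>x. jap' (f x - f0 x) * w x * (g x - f x) \<partial>M)"
proof -
  have w0: "AE x in M. 0 \<le> w x" using w by eventually_elim simp
  have [measurable]: "k \<in> borel_measurable M" if "k \<in> C" for k
    using meas that by blast
  note [measurable] = f g
  have J_int: "integrable M (\<lambda>x. jap (f x - f0 x) * w x)" if "f \<in> C" for f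
    using that w w_int int by (intro integrable_jap) auto
  define t :: "nat \<Rightarrow> real" where "t n = 1 / (real n + 1)" for n
  have t: "0 < t n" "t n \<le> 1" for n by (auto simp: t_def)
  define k where "k n x = t n * g x + (1 - t n) * f x" for n x
  have k: "k n \<in> C" for n
    using conv f g t[of n] unfolding k_def convex_fset_def by simp
  note [measurable] = k
  have gf_int: "integrable M (\<lambda>x. \<bar>(g x - f x) * w x\<bar>)"
    using int(1)[OF f] int(1)[OF g] by (intro integrable_abs) (simp add: left_diff_distrib)
  have dom: "norm (jap' z * w x * (g x - f x)) \<le> \<bar>(g x - f x) * w x\<bar>" for x z
    using mult_right_mono[OF abs_jap'_le[of z], of "\<bar>w x * (g x - f x)\<bar>"]
    by (simp add: abs_mult mult_ac)
  have v_int: "integrable M (\<lambda>x. jap' (k n x - f0 x) * w x * (g x - f x))" for n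
    using gf_int by (rule Bochner_Integration.integrable_bound) (use dom in auto)
  have nonneg: "0 \<le> (\<integral>x. jap' (k n x - f0 x) * w x * (g x - f x) \<partial>M)" for n
  proof -
    have "0 \<le> (\<integral>x. jap (k n x - f0 x) * w x \<partial>M) - (\<integral>x. jap (f x - f0 x) * w x \<partial>M)"
      using mini[OF k[of n]] by simp
    also have "\<dots> = (\<integral>x. jap (k n x - f0 x) * w x - jap (f x - f0 x) * w x \<partial>M)"
      using J_int[OF k] J_int[OF f] by simp
    also have "\<dots> \<le> (\<integral>x. t n * (jap' (k n x - f0 x) * w x * (g x - f x)) \<partial>M)"
    proof (rule integral_mono_AE)
      show "AE x in M. jap (k n x - f0 x) * w x - jap (f x - f0 x) * w x
          \<le> t n * (jap' (k n x - f0 x) * w x * (g x - f x))"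
        using w0
      proof eventually_elim
        case (elim x)
        have "jap (k n x - f0 x) - jap (f x - f0 x) \<le> jap' (k n x - f0 x) * (k n x - f x)"
          using jap_diff_le[of "k n x - f0 x" "f x - f0 x"] by simp
        also have "k n x - f x = t n * (g x - f x)"
          by (simp add: k_def algebra_simps)
        finally have "(jap (k n x - f0 x) - jap (f x - f0 x)) * w x
            \<le> jap' (k n x - f0 x) * (t n * (g x - f x)) * w x"
          using elim by (rule mult_right_mono)
        then show ?case by (simp add: algebra_simps)
      qed
    qed (use J_int[OF k] J_int[OF f] v_int in simp_all)
    finally show ?thesis
      using t[of n] by (simp add: zero_le_mult_iff)
  qed
  have "(\<lambda>n. \<integral>x. jap' (k n x - f0 x) * w x * (g x - f x) \<partial>M)
      \<longlonglongrightarrow> (\<integral>x. jap' (f x - f0 x) * w x * (g x - f x) \<partial>M)"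
  proof (rule integral_dominated_convergence[OF _ _ gf_int])
    have "t \<longlonglongrightarrow> 0"
      unfolding t_def using LIMSEQ_inverse_real_of_nat by (simp add: inverse_eq_divide add.commute)
    then have "(\<lambda>n. k n x) \<longlonglongrightarrow> 0 * g x + (1 - 0) * f x" for x
      unfolding k_def by (intro tendsto_intros)
    then have "(\<lambda>n. jap' (k n x - f0 x)) \<longlonglongrightarrow> jap' (f x - f0 x)" for x
      by (intro continuous_on_tendsto_compose[OF continuous_on_jap'] tendsto_intros) auto
    then show "AE x in M. (\<lambda>n. jap' (k n x - f0 x) * w x * (g x - f x))
        \<longlonglongrightarrow> jap' (f x - f0 x) * w x * (g x - f x)"
      by (intro AE_I2 tendsto_intros)
    show "AE x in M. norm (jap' (k n x - f0 x) * w x * (g x - f x)) \<le> \<bar>(g x - f x) * w x\<bar>" for n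
      using dom by simp
  qed measurable
  then show ?thesis
    by (rule LIMSEQ_le_const) (use nonneg in blast)
qed

end

section \<open>Equicontinuous Koethe topologies\<close>

lemma fspan_scale:
  assumes "f \<in> scale_set l S"
  shows "f \<in> fspan S"
proof -
  obtain k where k: "k \<in> S" "f = (\<lambda>x. l * k x)"
    using assms by (auto simp: scale_set_def)
  then show ?thesis
    unfolding fspan_def
    by (intro CollectI exI[of _ "1::nat"] exI[of _ "\<lambda>_. l"] exI[of _ "\<lambda>_. k"]) simp
qed

lemma fspan_measurable:
  assumes "S \<subseteq> borel_measurable M" "f \<in> fspan S"
  shows "f \<in> borel_measurable M"
proof -
  obtain n :: nat and c h where h: "\<And>i. i < n \<Longrightarrow> h i \<in> S" and f: "f = (\<lambda>x. \<Sum>i<n. c i * h i x)"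
    using assms(2) by (auto simp: fspan_def)
  have "h i \<in> borel_measurable M" if "i < n" for i
    using h[OF that] assms(1) by blast
  then show ?thesis
    unfolding f by (intro borel_measurable_sum borel_measurable_times) auto
qed

text \<open>Bilinear expansion reduces to one factor in \<open>K\<close> and one in its polar, where
  the product has \<open>L1\<close> norm at most 1.\<close>

lemma integrable_fspan_polar:
  assumes K: "K \<subseteq> borel_measurable M" and f: "f \<in> fspan K" and g: "g \<in> fspan (polar M K)"
  shows "integrable M (\<lambda>x. f x * g x)"
proof -
  obtain n :: nat and c h where h: "\<And>i. i < n \<Longrightarrow> h i \<in> K" and f_eq: "f = (\<lambda>x. \<Sum>i<n. c i * h i x)"
    using f by (auto simp: fspan_def)
  obtain m :: nat and d p where p: "\<And>j. j < m \<Longrightarrow> p j \<in> polar M K" and g_eq: "g = (\<lambda>x. \<Sum>j<m. d j * p j x)"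
    using g by (auto simp: fspan_def)
  have "integrable M (\<lambda>x. k x * q x)" if "k \<in> K" "q \<in> polar M K" for k q
  proof (rule integrableI_bounded)
    show "(\<lambda>x. k x * q x) \<in> borel_measurable M"
      using that K by (intro borel_measurable_times) (auto simp: polar_def L0_def)
    have "(\<integral>\<^sup>+x. ennreal \<bar>k x * q x\<bar> \<partial>M) \<le> 1"
      using that by (auto simp: polar_def)
    then show "(\<integral>\<^sup>+x. ennreal (norm (k x * q x)) \<partial>M) < \<infinity>"
      using le_less_trans by fastforce
  qed
  then have "integrable M (\<lambda>x. \<Sum>i<n. \<Sum>j<m. (c i * d j) * (h i x * p j x))"
    using h p by (intro Bochner_Integration.integrable_sum integrable_mult_right) auto
  then show ?thesis
    by (simp add: f_eq g_eq sum_product mult_ac)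
qed

lemma closed_in_prob_scale_set:
  assumes K: "closed_in_prob M K" and l: "l > 0"
  shows "closed_in_prob M (scale_set l K)"
  unfolding closed_in_prob_def
proof (intro conjI allI impI)
  show "scale_set l K \<subseteq> L0 M"
    using K by (auto simp: scale_set_def closed_in_prob_def L0_def intro!: borel_measurable_times)
next
  fix fs f assume fs: "\<forall>n. fs n \<in> scale_set l K" and f: "f \<in> L0 M" and conv: "conv_in_prob M fs f"
  have "\<exists>k. k \<in> K \<and> fs n = (\<lambda>x. l * k x)" for n
    using fs by (auto simp: scale_set_def)
  then obtain ks where ks: "\<And>n. ks n \<in> K" "\<And>n. fs n = (\<lambda>x. l * ks n x)"
    by metis
  have "conv_in_prob M ks (\<lambda>x. f x / l)"
    unfolding conv_in_prob_def
  proof (intro allI impI)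
    fix e :: real assume "e > 0"
    have "e < \<bar>ks n x - f x / l\<bar> \<longleftrightarrow> l * e < \<bar>fs n x - f x\<bar>" for n x
    proof -
      have "\<bar>fs n x - f x\<bar> = l * \<bar>ks n x - f x / l\<bar>"
        using l by (simp add: ks(2) abs_mult_pos' algebra_simps)
      then show ?thesis using l by simp
    qed
    then show "(\<lambda>n. measure M {x \<in> space M. e < \<bar>ks n x - f x / l\<bar>}) \<longlonglongrightarrow> 0"
      using conv l \<open>e > 0\<close> by (simp add: conv_in_prob_def)
  qed
  moreover have "(\<lambda>x. f x / l) \<in> L0 M"
    using f by (simp add: L0_def)
  ultimately have "(\<lambda>x. f x / l) \<in> K"
    using K ks(1) unfolding closed_in_prob_def by blast
  then show "f \<in> scale_set l K"
    unfolding scale_set_def using l by (intro image_eqI[of _ _ "\<lambda>x. f x / l"]) auto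
qed

lemma continuous_map_weak_top:
  assumes "g \<in> F"
  shows "continuous_map (weak_top M E F) euclideanreal (\<lambda>f. pairing M f g)"
proof -
  have "continuous_map (weak_top M E F) euclideanreal
      ((\<lambda>x. x g) \<circ> (\<lambda>f. restrict (\<lambda>g. pairing M f g) F))"
    unfolding weak_top_def
    by (intro continuous_map_pullback continuous_map_product_projection assms)
  then show ?thesis
    using assms by (simp add: o_def)
qed

lemma topspace_weak_top: "topspace (weak_top M E F) = E"
  by (auto simp: weak_top_def topspace_pullback_topology)

text \<open>\<open>T\<close> is not known to be first countable, so a point whose neighbourhoods are
  visited infinitely often stands in for a convergent subsequence.\<close>

lemma compactin_cluster_point:
  assumes S: "compactin X S" and s: "\<And>n::nat. s n \<in> S"
  shows "\<exists>p\<in>S. \<forall>U. openin X U \<longrightarrow> p \<in> U \<longrightarrow> infinite {n. s n \<in> U}"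
proof (rule ccontr)
  assume "\<not> ?thesis"
  then obtain U where U: "\<And>p. p \<in> S \<Longrightarrow> openin X (U p) \<and> p \<in> U p \<and> finite {n. s n \<in> U p}"
    by metis
  then have "\<forall>V\<in>U ` S. openin X V" "S \<subseteq> \<Union> (U ` S)"
    by auto
  then obtain \<F> where \<F>: "finite \<F>" "\<F> \<subseteq> U ` S" "S \<subseteq> \<Union>\<F>"
    using S unfolding compactin_def by meson
  then have "(UNIV :: nat set) \<subseteq> (\<Union>V\<in>\<F>. {n. s n \<in> V})"
    using s by blast
  moreover have "finite (\<Union>V\<in>\<F>. {n. s n \<in> V})"
    using \<F> U by auto
  ultimately show False
    using finite_subset by auto
qed

section \<open>Continuity of pairings, separation, and the Fatou property\<close>

locale Koethe_topology = prob_space M for M :: "'a measure" +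
  fixes K F :: "('a \<Rightarrow> real) set" and T :: "('a \<Rightarrow> real) topology"
  assumes K_convex: "abs_convex K"
    and K_closed: "closed_in_prob M K"
    and lc: "locally_convex_top (fspan K) T"
    and KS: "Krein_Smulian K T"
    and ind: "induces M K F T"
begin

abbreviation E :: "('a \<Rightarrow> real) set" where "E \<equiv> fspan K"

lemma zero_in_E: "(\<lambda>x. 0) \<in> E"
  unfolding fspan_def by (intro CollectI exI[of _ "0::nat"]) auto

lemma subspace_E: "subspace E"
  using zero_in_E by (intro subspace_lc[OF lc]) auto

lemma topspace_T: "topspace T = E"
  by (rule topspace_lc[OF lc])

lemma K_measurable: "K \<subseteq> borel_measurable M"
  using K_closed by (simp add: closed_in_prob_def L0_def)

lemma E_measurable: "f \<in> E \<Longrightarrow> f \<in> borel_measurable M"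
  by (rule fspan_measurable[OF K_measurable])

lemma integrable_E_F: "f \<in> E \<Longrightarrow> g \<in> F \<Longrightarrow> integrable M (\<lambda>x. f x * g x)"
  using ind by (intro integrable_fspan_polar[OF K_measurable]) (auto simp: induces_def dual_space_def)

lemma F_measurable: "g \<in> F \<Longrightarrow> g \<in> borel_measurable M"
proof -
  assume "g \<in> F"
  moreover have "polar M K \<subseteq> borel_measurable M"
    by (auto simp: polar_def L0_def)
  ultimately show ?thesis
    using ind fspan_measurable[of "polar M K"] by (auto simp: induces_def dual_space_def)
qed

lemma solidD:
  assumes "g \<in> F" "h \<in> borel_measurable M" "AE x in M. \<bar>h x\<bar> \<le> \<bar>g x\<bar>"
  shows "h \<in> F"
  using ind assms unfolding induces_def solid_def L0_def by blast

lemma pairing_lincomb: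
  assumes "f \<in> E" "h \<in> E" "g \<in> F"
  shows "pairing M (a *\<^sub>R f + b *\<^sub>R h) g = a * pairing M f g + b * pairing M h g"
  using integrable_E_F[OF assms(1,3)] integrable_E_F[OF assms(2,3)]
  by (simp add: pairing_def distrib_right mult.assoc)

lemma convex_scale_set: "convex (scale_set l K)"
proof -
  have "convex_fset K"
    using K_convex by (auto simp: abs_convex_def convex_fset_def)
  then have "convex ((*\<^sub>R) l ` K)"
    by (simp add: convex_fset_iff_convex convex_scaling)
  also have "(*\<^sub>R) l ` K = scale_set l K"
    by (simp add: scale_set_def scaleR_fun_def)
  finally show ?thesis .
qed

text \<open>\<open>T\<close> need not be Hausdorff, as representatives are not identified, so compactness of
  \<open>K\<close> does not give closedness; the Krein-Smulian property of the whole space does.\<close>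

lemma closedin_scale_set:
  assumes "l > 0"
  shows "closedin T (scale_set l K)"
proof -
  have "convex_fset E"
    using subspace_E by (simp add: convex_fset_iff_convex subspace_imp_convex)
  moreover have "closedin T E"
    using closedin_topspace[of T] by (simp add: topspace_T)
  ultimately have "closedin T (E \<inter> scale_set l K)"
    using KS assms unfolding Krein_Smulian_def by blast
  moreover have "E \<inter> scale_set l K = scale_set l K"
    using fspan_scale by blast
  ultimately show ?thesis by simp
qed

text \<open>The topologies are compared on \<open>K\<close>-bounded sets only. Half-spaces are
  convex, so the Krein-Smulian property passes from their bounded pieces to the whole; the opposite
  half-spaces come from \<open>- g\<close>, which solidity keeps in \<open>F\<close>.\<close>

lemma continuous_map_pairing:
  assumes g: "g \<in> F"
  shows "continuous_map T euclideanreal (\<lambda>f. pairing M f g)"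
proof -
  have le: "closedin T {f \<in> E. pairing M f g \<le> a}" if g: "g \<in> F" for g a
  proof -
    define C where "C = {f \<in> E. pairing M f g \<le> a}"
    have "convex C"
    proof (rule convexI)
      fix f h and u v :: real assume "f \<in> C" "h \<in> C" "0 \<le> u" "0 \<le> v" "u + v = 1"
      then show "u *\<^sub>R f + v *\<^sub>R h \<in> C"
        unfolding C_def using subspace_E pairing_lincomb[OF _ _ g] convex_bound_le[of _ a _ u v]
        by (auto intro: subspace_add subspace_scale)
    qed
    moreover have "closedin T (C \<inter> scale_set l K)" if "l > 0" for l
    proof -
      have "K_bounded K (scale_set l K)" "scale_set l K \<subseteq> E"
        using that fspan_scale by (auto simp: K_bounded_def)
      then have eq: "subtopology T (scale_set l K) = subtopology (weak_top M E F) (scale_set l K)"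
        using ind unfolding induces_def by blast
      have "closedin (weak_top M E F) C"
        using closedin_continuous_map_preimage[OF continuous_map_weak_top[OF g], of "{..a}" M E]
        by (simp add: C_def topspace_weak_top)
      then have "closedin (subtopology T (scale_set l K)) (C \<inter> scale_set l K)"
        unfolding eq closedin_subtopology by blast
      then show ?thesis
        using closedin_scale_set[OF that] by (rule closedin_trans_full)
    qed
    moreover have "C \<subseteq> E" by (auto simp: C_def)
    ultimately have "closedin T C"
      using KS unfolding Krein_Smulian_def convex_fset_iff_convex by blast
    then show ?thesis by (simp add: C_def)
  qed
  have neg: "(\<lambda>x. - g x) \<in> F"
    using F_measurable[OF g] by (intro solidD[OF g]) auto
  have "{f \<in> E. a \<le> pairing M f g} = {f \<in> E. pairing M f (\<lambda>x. - g x) \<le> - a}" for a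
    by (auto simp: pairing_def)
  then show ?thesis
    unfolding continuous_map_upper_lower_semicontinuous_le topspace_T
    using le[OF g] le[OF neg] by simp
qed

text \<open>The separating element is the first-order condition at the minimiser of a weighted distance
  to \<open>f0\<close>; since \<open>jap'\<close> is bounded, it lies in \<open>F\<close> by solidity.\<close>

lemma separation_from_closed_in_prob:
  assumes C: "C \<subseteq> E" "convex_fset C" "closed_in_prob M C" and f0: "f0 \<in> E" "f0 \<notin> C"
  shows "\<exists>g\<in>F. \<exists>d>0. \<forall>f\<in>C. pairing M f0 g + d \<le> pairing M f g"
proof (cases "C = {}")
  case True
  have "\<exists>g. g \<in> F"
    using ind by (auto simp: induces_def has_strictly_pos_def)
  then show ?thesis
    using True by (auto intro: exI[of _ 1])
next
  case False
  obtain g0 where g0: "g0 \<in> F" "AE x in M. 0 < g0 x"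
    using ind by (auto simp: induces_def has_strictly_pos_def)
  note [measurable] = F_measurable[OF g0(1)] E_measurable[OF f0(1)]
  \<comment> \<open>The cap at 1 makes \<open>w\<close> integrable; solidity keeps it in
    \<open>F\<close>.\<close>
  define w where "w x = min 1 (g0 x)" for x
  have w_meas [measurable]: "w \<in> borel_measurable M"
    unfolding w_def by measurable
  have w: "AE x in M. 0 < w x"
    using g0(2) by eventually_elim (simp add: w_def)
  have wF: "w \<in> F"
    using g0(2) by (intro solidD[OF g0(1)] w_meas) (auto elim!: eventually_mono simp: w_def)
  have w_int: "integrable M w"
    using w by (intro integrable_const_bound[where B=1]) (auto elim!: eventually_mono simp: w_def)
  have int: "integrable M (\<lambda>x. f x * w x)" if "f \<in> E" for f
    using integrable_E_F[OF that wF] .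
  have "\<exists>f\<in>C. \<forall>g\<in>C. (\<integral>x. jap (f x - f0 x) * w x \<partial>M) \<le> (\<integral>x. jap (g x - f0 x) * w x \<partial>M)"
    using C(1) int f0(1) by (intro ex_jap_minimiser[OF C(2,3) False _ _ w w_int]) auto
  then obtain f where f: "f \<in> C" and
    mini: "\<And>g. g \<in> C \<Longrightarrow> (\<integral>x. jap (f x - f0 x) * w x \<partial>M) \<le> (\<integral>x. jap (g x - f0 x) * w x \<partial>M)"
    by blast
  have fE: "f \<in> E" using f C(1) by blast
  note [measurable] = E_measurable[OF fE]
  define g where "g x = jap' (f x - f0 x) * w x" for x
  have g_meas [measurable]: "g \<in> borel_measurable M"
    unfolding g_def by measurable
  have gF: "g \<in> F"
  proof (rule solidD[OF wF g_meas])
    show "AE x in M. \<bar>g x\<bar> \<le> \<bar>w x\<bar>"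
      using mult_right_mono[OF abs_jap'_le] by (intro AE_I2) (fastforce simp: g_def abs_mult)
  qed
  have pair_diff: "pairing M h g - pairing M k g = (\<integral>x. (h x - k x) * g x \<partial>M)" if "h \<in> E" "k \<in> E" for h k
    using integrable_E_F[OF that(1) gF] integrable_E_F[OF that(2) gF]
    by (simp add: pairing_def left_diff_distrib)
  \<comment> \<open>The integrand is \<open>(f - f0)\<^sup>2 * w / jap (f - f0)\<close>, so
    \<open>d\<close> vanishes only if \<open>f = f0\<close> almost everywhere.\<close>
  define d where "d = (\<integral>x. (f x - f0 x) * g x \<partial>M)"
  have sgn: "AE x in M. 0 \<le> (f x - f0 x) * g x"
    using w
  proof eventually_elim
    case (elim x)
    have "(f x - f0 x) * g x = (f x - f0 x)\<^sup>2 * (w x / jap (f x - f0 x))"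
      by (simp add: g_def jap'_def power2_eq_square)
    then show ?case
      using elim jap_pos[of "f x - f0 x"] by simp
  qed
  have "d \<noteq> 0"
  proof
    assume "d = 0"
    moreover have "integrable M (\<lambda>x. (f x - f0 x) * g x)"
      using integrable_E_F[OF fE gF] integrable_E_F[OF f0(1) gF] by (simp add: left_diff_distrib)
    ultimately have "AE x in M. (f x - f0 x) * g x = 0"
      using integral_nonneg_eq_0_iff_AE[OF _ sgn] by (simp add: d_def)
    then have "AE x in M. f x = f0 x"
      using w
    proof eventually_elim
      case (elim x)
      then show ?case using jap_pos[of "f x - f0 x"] by (auto simp: g_def jap'_def)
    qed
    \<comment> \<open>A set closed in probability absorbs almost everywhere modifications: the
      constant sequence \<open>f\<close> converges to \<open>f0\<close>.\<close>
    then have "conv_in_prob M (\<lambda>_. f) f0"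
      by (intro AE_tendsto_imp_conv_in_prob) (auto elim!: eventually_mono)
    then have "f0 \<in> C"
      using C(3)[unfolded closed_in_prob_def, THEN conjunct2, rule_format, of "\<lambda>_. f" f0]
        f E_measurable[OF f0(1)] by (simp add: L0_def)
    then show False using f0(2) by simp
  qed
  moreover have "0 \<le> d"
    unfolding d_def using sgn by (rule integral_nonneg_AE)
  ultimately have "d > 0" by simp
  moreover have "pairing M f0 g + d \<le> pairing M h g" if h: "h \<in> C" for h
  proof -
    have "0 \<le> (\<integral>x. jap' (f x - f0 x) * w x * (h x - f x) \<partial>M)"
      using C E_measurable int f0(1)
      by (intro jap_minimiser_variational[OF C(2) f h _ _ _ w w_int _ _ mini]) auto
    also have "\<dots> = pairing M h g - pairing M f g"
      using h C(1) fE by (subst pair_diff) (auto simp: g_def mult_ac)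
    finally show ?thesis
      using pair_diff[OF fE f0(1)] by (simp add: d_def)
  qed
  ultimately show ?thesis using gF by blast
qed

text \<open>Sequences in a sublevel set cut by \<open>scale_set l K\<close> are
  \<open>K\<close>-bounded, so the Fatou property keeps their limits in probability in that piece.
  Each point off the piece then has an open half-space around it that misses the piece.\<close>

lemma Fatou_imp_lsc:
  assumes conv: "convex_fun E \<phi>" and fatou: "equicont_Fatou M K \<phi>"
  shows "lsc_top T \<phi>"
proof -
  have closed: "closedin T {f \<in> E. \<phi> f \<le> ereal c}" for c
  proof -
    define S where "S = {f \<in> E. \<phi> f \<le> ereal c}"
    have S: "convex S"
    proof (rule convexI)
      fix f h and u v :: real assume *: "f \<in> S" "h \<in> S" "0 \<le> u" "0 \<le> v" "u + v = 1"
      then have "u *\<^sub>R (f, c) + v *\<^sub>R (h, c) \<in> {(h, r). h \<in> E \<and> \<phi> h \<le> ereal r}"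
        by (intro convexD[OF convex_epigraph[OF lc subspace_E conv]]) (auto simp: S_def)
      moreover have "u * c + v * c = c"
        using * by (simp add: distrib_right[symmetric])
      ultimately show "u *\<^sub>R f + v *\<^sub>R h \<in> S"
        by (simp add: S_def)
    qed
    have "closedin T (S \<inter> scale_set l K)" if l: "l > 0" for l
    proof -
      define C where "C = S \<inter> scale_set l K"
      have conv_C: "convex_fset C"
        unfolding C_def convex_fset_iff_convex by (intro convex_Int S convex_scale_set)
      have closed_C: "closed_in_prob M C"
        unfolding closed_in_prob_def
      proof (intro conjI allI impI)
        show "C \<subseteq> L0 M"
          using E_measurable by (auto simp: C_def S_def L0_def)
      next
        fix fs f assume fs: "\<forall>n. fs n \<in> C" and f: "f \<in> L0 M" and lim: "conv_in_prob M fs f"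
        have f_lK: "f \<in> scale_set l K"
          using closed_in_prob_scale_set[OF K_closed l] fs f lim
          unfolding closed_in_prob_def C_def by blast
        then have fE: "f \<in> E" by (rule fspan_scale)
        have "K_bounded K (range fs)"
          using fs l by (auto simp: K_bounded_def C_def)
        then have "\<phi> f \<le> liminf (\<lambda>n. \<phi> (fs n))"
          using fatou fE lim by (simp add: equicont_Fatou_def)
        also have "\<dots> \<le> liminf (\<lambda>n. ereal c)"
          using fs by (intro Liminf_mono) (auto simp: C_def S_def)
        also have "\<dots> = ereal c" by (simp add: Liminf_const)
        finally show "f \<in> C"
          using fE f_lK by (simp add: C_def S_def)
      qed
      have "\<exists>U. openin T U \<and> f0 \<in> U \<and> U \<subseteq> E - C" if f0: "f0 \<in> E - C" for f0
      proof -
        have "C \<subseteq> E" by (auto simp: C_def S_def)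
        then obtain g d where g: "g \<in> F" "d > 0" "\<And>f. f \<in> C \<Longrightarrow> pairing M f0 g + d \<le> pairing M f g"
          using separation_from_closed_in_prob[OF _ conv_C closed_C, of f0] f0 by blast
        define U where "U = {f \<in> E. pairing M f g < pairing M f0 g + d}"
        have "openin T U"
          using openin_continuous_map_preimage[OF continuous_map_pairing[OF g(1)], of "{..<pairing M f0 g + d}"]
          by (simp add: U_def topspace_T)
        moreover have "f0 \<in> U" "U \<subseteq> E - C"
          using g f0 by (force simp: U_def)+
        ultimately show ?thesis by blast
      qed
      then have "openin T (E - C)"
        by (subst openin_subopen) blast
      then show ?thesis
        unfolding C_def[symmetric] closedin_def topspace_T by (auto simp: C_def S_def)
    qed
    moreover have "S \<subseteq> E" by (auto simp: S_def)
    ultimately have "closedin T S"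
      using KS S unfolding Krein_Smulian_def convex_fset_iff_convex by blast
    then show ?thesis by (simp add: S_def)
  qed
  show ?thesis
    unfolding lsc_top_def topspace_T
  proof (intro ballI allI impI)
    fix f c assume f: "f \<in> E" and c: "c < \<phi> f"
    obtain r where r: "c < ereal r" "ereal r < \<phi> f"
      using c ereal_dense2 by blast
    show "\<exists>U. openin T U \<and> f \<in> U \<and> (\<forall>h\<in>U. c < \<phi> h)"
    proof (intro exI conjI)
      show "openin T (topspace T - {f \<in> E. \<phi> f \<le> ereal r})"
        using closed by (intro openin_diff openin_topspace)
      show "f \<in> topspace T - {f \<in> E. \<phi> f \<le> ereal r}"
        using f r by (simp add: topspace_T)
      show "\<forall>h\<in>topspace T - {f \<in> E. \<phi> f \<le> ereal r}. c < \<phi> h"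
        using r(1) by (auto simp: topspace_T not_le intro: less_trans)
    qed
  qed
qed

text \<open>Truncating \<open>g\<close> to the sets where all \<open>fs n * g\<close> are bounded by \<open>m\<close> gives elements of \<open>F\<close>
  for which dominated convergence applies, so no uniform integrability of \<open>K\<close> is needed.\<close>

lemma cluster_point_AE_eq:
  assumes fs: "\<And>n. fs n \<in> E" and f: "f \<in> E" and f': "f' \<in> E"
    and lim: "AE x in M. (\<lambda>n. fs n x) \<longlonglongrightarrow> f x"
    and cluster: "\<And>U. openin T U \<Longrightarrow> f' \<in> U \<Longrightarrow> infinite {n. fs n \<in> U}"
  shows "AE x in M. f' x = f x"
proof (rule ccontr)
  assume "\<not> ?thesis"
  then obtain g where g: "g \<in> F" "pairing M f' g \<noteq> pairing M f g"
    using ind f f' unfolding induces_def separates_points_def by blast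
  note [measurable] = F_measurable[OF g(1)] E_measurable[OF f] E_measurable[OF f'] E_measurable[OF fs]
  define A where "A m = {x \<in> space M. \<forall>n. \<bar>fs n x * g x\<bar> \<le> real m}" for m
  have [measurable]: "A m \<in> sets M" for m
    unfolding A_def by measurable
  define gm where "gm m x = g x * indicator (A m) x" for m x
  have gm_meas [measurable]: "gm m \<in> borel_measurable M" for m
    unfolding gm_def by measurable
  have gmF: "gm m \<in> F" for m
    by (rule solidD[OF g(1) gm_meas]) (auto simp: gm_def indicator_def)
  have lim_m: "(\<lambda>n. pairing M (fs n) (gm m)) \<longlonglongrightarrow> pairing M f (gm m)" for m
    unfolding pairing_def
  proof (rule integral_dominated_convergence[where w="\<lambda>_. real m"])
    show "AE x in M. (\<lambda>n. fs n x * gm m x) \<longlonglongrightarrow> f x * gm m x"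
      using lim by eventually_elim (intro tendsto_intros)
    show "AE x in M. norm (fs n x * gm m x) \<le> real m" for n
      by (intro AE_I2) (auto simp: gm_def A_def indicator_def)
  qed auto
  have eq_m: "pairing M f' (gm m) = pairing M f (gm m)" for m
  proof (rule ccontr)
    assume ne: "\<not> ?thesis"
    define e where "e = \<bar>pairing M f' (gm m) - pairing M f (gm m)\<bar> / 2"
    have e: "e > 0" using ne by (simp add: e_def)
    define U where "U = {h \<in> E. pairing M h (gm m) \<in> ball (pairing M f' (gm m)) e}"
    have "openin T U"
      using openin_continuous_map_preimage[OF continuous_map_pairing[OF gmF[of m]], of "ball (pairing M f' (gm m)) e"]
      by (simp add: U_def topspace_T)
    moreover have "f' \<in> U"
      using f' e by (simp add: U_def)
    ultimately have inf: "infinite {n. fs n \<in> U}" by (rule cluster)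
    have "eventually (\<lambda>n. dist (pairing M (fs n) (gm m)) (pairing M f (gm m)) < e) sequentially"
      using lim_m e by (rule tendstoD)
    then obtain N where N: "\<And>n. n \<ge> N \<Longrightarrow> dist (pairing M (fs n) (gm m)) (pairing M f (gm m)) < e"
      by (auto simp: eventually_sequentially)
    obtain n where n: "n \<ge> N" "fs n \<in> U"
      using inf by (auto simp: infinite_nat_iff_unbounded_le)
    then have "\<bar>pairing M f' (gm m) - pairing M (fs n) (gm m)\<bar> < e"
      by (simp add: U_def dist_real_def)
    moreover have "\<bar>pairing M (fs n) (gm m) - pairing M f (gm m)\<bar> < e"
      using N[OF n(1)] by (simp add: dist_real_def)
    moreover have "\<bar>pairing M f' (gm m) - pairing M f (gm m)\<bar> = 2 * e"
      by (simp add: e_def)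
    ultimately show False
      by linarith
  qed
  \<comment> \<open>A convergent sequence of reals is bounded, so almost every point enters
    \<open>A m\<close> eventually.\<close>
  have ev: "AE x in M. eventually (\<lambda>m. gm m x = g x) sequentially"
    using lim AE_space
  proof eventually_elim
    case (elim x)
    have "(\<lambda>n. fs n x * g x) \<longlonglongrightarrow> f x * g x"
      using elim by (intro tendsto_intros)
    then have "Bseq (\<lambda>n. fs n x * g x)"
      by (intro convergent_imp_Bseq) (auto simp: convergent_def)
    then obtain B where B: "\<And>n. \<bar>fs n x * g x\<bar> \<le> B"
      by (auto simp: Bseq_def)
    have "gm m x = g x" if "m \<ge> nat \<lceil>B\<rceil>" for m
    proof -
      have "B \<le> real m" using that by linarith
      then have "x \<in> A m" using B elim order_trans unfolding A_def by blast
      then show ?thesis by (simp add: gm_def)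
    qed
    then show ?case
      unfolding eventually_sequentially by blast
  qed
  have conv: "(\<lambda>m. pairing M h (gm m)) \<longlonglongrightarrow> pairing M h g" if h: "h \<in> E" for h
    unfolding pairing_def
  proof (rule integral_dominated_convergence[where w="\<lambda>x. \<bar>h x * g x\<bar>"])
    show "AE x in M. (\<lambda>m. h x * gm m x) \<longlonglongrightarrow> h x * g x"
      using ev by eventually_elim (intro tendsto_intros tendsto_eventually)
    show "AE x in M. norm (h x * gm m x) \<le> \<bar>h x * g x\<bar>" for m
      by (intro AE_I2) (auto simp: gm_def indicator_def)
    show "integrable M (\<lambda>x. \<bar>h x * g x\<bar>)"
      using integrable_E_F[OF h g(1)] by (rule integrable_abs)
  qed (use E_measurable[OF h] in measurable)
  have "pairing M f' g = pairing M f g"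
    using conv[OF f'] conv[OF f] unfolding eq_m by (rule LIMSEQ_unique)
  then show False using g(2) by simp
qed

text \<open>If the inequality failed, some level \<open>c\<close> below \<open>\<phi> f\<close>
  would exceed \<open>\<phi>\<close> along a subsequence. Its cluster point equals \<open>f\<close>
  only almost everywhere, whence \<open>AE_eq\<close>; lower semicontinuity there puts a
  neighbourhood above \<open>c\<close>, which the subsequence visits.\<close>

lemma lsc_imp_Fatou:
  assumes lsc: "lsc_top T \<phi>"
    and AE_eq: "\<forall>f\<in>E. \<forall>h\<in>E. (AE x in M. f x = h x) \<longrightarrow> \<phi> f = \<phi> h"
  shows "equicont_Fatou M K \<phi>"
  unfolding equicont_Fatou_def
proof (intro allI impI)
  fix fs :: "nat \<Rightarrow> 'a \<Rightarrow> real" and f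
  assume bdd: "K_bounded K (range fs)" and f: "f \<in> E" and lim: "conv_in_prob M fs f"
  show "\<phi> f \<le> liminf (\<lambda>n. \<phi> (fs n))"
  proof (rule ccontr)
    assume "\<not> ?thesis"
    then have "liminf (\<lambda>n. \<phi> (fs n)) < \<phi> f"
      by (simp only: not_le)
    from dense[OF this] obtain c where c: "liminf (\<lambda>n. \<phi> (fs n)) < c" "c < \<phi> f"
      by blast
    obtain l where l: "l > 0" "\<And>n. fs n \<in> scale_set l K"
      using bdd by (auto simp: K_bounded_def)
    have "\<not> eventually (\<lambda>n. c \<le> \<phi> (fs n)) sequentially"
      using c(1) Liminf_bounded[of c "\<lambda>n. \<phi> (fs n)" sequentially] by auto
    from not_eventually_sequentiallyD[OF this]
    obtain r :: "nat \<Rightarrow> nat" where r: "strict_mono r" "\<And>n. \<phi> (fs (r n)) < c"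
      by (auto simp: not_le)
    have "conv_in_prob M (\<lambda>n. fs (r n)) f"
      using lim LIMSEQ_subseq_LIMSEQ[OF _ r(1)] unfolding conv_in_prob_def o_def by blast
    moreover have "fs n \<in> E" for n
      using fspan_scale l(2) by blast
    ultimately obtain q :: "nat \<Rightarrow> nat" where q: "strict_mono q" "AE x in M. (\<lambda>n. fs (r (q n)) x) \<longlonglongrightarrow> f x"
      using conv_in_prob_imp_AE_subseq[of "\<lambda>n. fs (r n)" f] E_measurable f by blast
    have "continuous_map T T (\<lambda>f. l *\<^sub>R f + 0)"
      using subspace_0[OF subspace_E] by (intro continuous_map_lincomb[OF lc]) (auto simp: topspace_T)
    moreover have "compactin T K"
      using ind by (simp add: induces_def)
    ultimately have "compactin T ((\<lambda>f. l *\<^sub>R f + 0) ` K)"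
      by (intro image_compactin)
    moreover have "(\<lambda>f. l *\<^sub>R f + 0) ` K = scale_set l K"
      by (simp add: scale_set_def scaleR_fun_def)
    ultimately obtain f' where f': "f' \<in> scale_set l K"
      "\<And>U. openin T U \<Longrightarrow> f' \<in> U \<Longrightarrow> infinite {n. fs (r (q n)) \<in> U}"
      using compactin_cluster_point[of T "scale_set l K" "\<lambda>n. fs (r (q n))"] l(2) by auto
    have f'E: "f' \<in> E" using fspan_scale[OF f'(1)] .
    have "AE x in M. f' x = f x"
      by (rule cluster_point_AE_eq[OF _ f f'E q(2) f'(2)]) (use l(2) fspan_scale in blast)
    then have "c < \<phi> f'"
      using AE_eq f f'E c(2) by metis
    from lsc[unfolded lsc_top_def topspace_T, rule_format, OF f'E this]
    obtain U where U: "openin T U" "f' \<in> U" "\<And>h. h \<in> U \<Longrightarrow> c < \<phi> h"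
      by blast
    have "{n. fs (r (q n)) \<in> U} \<noteq> {}"
      by (rule infinite_imp_nonempty[OF f'(2)[OF U(1,2)]])
    then obtain n where "fs (r (q n)) \<in> U" by blast
    from U(3)[OF this] r(2)[of "q n"] show False by simp
  qed
qed

section \<open>Conjugates and the dual representation\<close>

lemma conj_fun_not_MInf:
  assumes "proper_fun E \<phi>"
  shows "conj_fun M E \<phi> g \<noteq> -\<infinity>"
proof -
  obtain h r where h: "h \<in> E" "\<phi> h = ereal r"
    using assms unfolding proper_fun_def by (metis ereal_cases)
  have "ereal (pairing M h g) - \<phi> h \<le> conj_fun M E \<phi> g"
    unfolding conj_fun_def by (rule SUP_upper[OF h(1)])
  then show ?thesis using h(2) by auto
qed

lemma Young:
  assumes "proper_fun E \<phi>" "f \<in> E"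
  shows "ereal (pairing M f g) - conj_fun M E \<phi> g \<le> \<phi> f"
proof -
  have "ereal (pairing M f g) - \<phi> f \<le> conj_fun M E \<phi> g"
    unfolding conj_fun_def by (rule SUP_upper[OF assms(2)])
  moreover have "\<phi> f \<noteq> -\<infinity>" using assms by (auto simp: proper_fun_def)
  ultimately show ?thesis
    using conj_fun_not_MInf[OF assms(1), of g]
    by (cases "\<phi> f"; cases "conj_fun M E \<phi> g") auto
qed

text \<open>An affine minorant with value \<open>c\<close> at \<open>f\<close> and slope
  \<open>g\<close> says that the conjugate at \<open>g\<close> is at most
  \<open>pairing M f g - c\<close>; so \<open>g\<close> lifts the supremum to \<open>c\<close>, for
  every \<open>c\<close> below \<open>\<phi> f\<close>.\<close>

lemma lsc_imp_dual_representation: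
  assumes conv: "convex_fun E \<phi>" and proper: "proper_fun E \<phi>" and lsc: "lsc_top T \<phi>"
    and reg: "F_regular M K F T" and f: "f \<in> E"
  shows "\<phi> f = (SUP g\<in>F. ereal (pairing M f g) - conj_fun M E \<phi> g)"
proof (rule antisym)
  show "(SUP g\<in>F. ereal (pairing M f g) - conj_fun M E \<phi> g) \<le> \<phi> f"
    by (intro SUP_least Young proper f)
next
  show "\<phi> f \<le> (SUP g\<in>F. ereal (pairing M f g) - conj_fun M E \<phi> g)"
  proof (rule ccontr)
    assume "\<not> ?thesis"
    then have "(SUP g\<in>F. ereal (pairing M f g) - conj_fun M E \<phi> g) < \<phi> f"
      by (simp only: not_le)
    from ereal_dense2[OF this]
    obtain c where c: "(SUP g\<in>F. ereal (pairing M f g) - conj_fun M E \<phi> g) < ereal c" "ereal c < \<phi> f"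
      by blast
    obtain l where l: "l \<in> top_dual E T" "\<And>h. h \<in> E \<Longrightarrow> ereal (c + l h - l f) \<le> \<phi> h"
      using lsc_convex_affine_minorant[OF lc conv proper lsc f c(2)] by blast
    obtain g where g: "g \<in> F" "\<And>h. h \<in> E \<Longrightarrow> l h = pairing M h g"
      using reg l(1) unfolding F_regular_def by blast
    have "conj_fun M E \<phi> g \<le> ereal (pairing M f g - c)"
      unfolding conj_fun_def
    proof (rule SUP_least)
      fix h assume h: "h \<in> E"
      then show "ereal (pairing M h g) - \<phi> h \<le> ereal (pairing M f g - c)"
        using l(2)[OF h] g(2)[OF h] g(2)[OF f] by (cases "\<phi> h") auto
    qed
    then have "ereal c \<le> ereal (pairing M f g) - conj_fun M E \<phi> g"
      by (cases "conj_fun M E \<phi> g") auto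
    also have "\<dots> \<le> (SUP g\<in>F. ereal (pairing M f g) - conj_fun M E \<phi> g)"
      by (rule SUP_upper[OF g(1)])
    finally show False using c(1) by simp
  qed
qed

lemma dual_representation_imp_lsc:
  assumes proper: "proper_fun E \<phi>"
    and rep: "\<forall>f\<in>E. \<phi> f = (SUP g\<in>F. ereal (pairing M f g) - conj_fun M E \<phi> g)"
  shows "lsc_top T \<phi>"
  unfolding lsc_top_def topspace_T
proof (intro ballI allI impI)
  fix f c assume f: "f \<in> E" and c: "c < \<phi> f"
  then obtain g where g: "g \<in> F" "c < ereal (pairing M f g) - conj_fun M E \<phi> g"
    using rep by (auto simp: less_SUP_iff)
  \<comment> \<open>The value \<open>\<infinity>\<close> would make the difference
    \<open>-\<infinity>\<close>, which is not above \<open>c\<close>; properness excludes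
    \<open>-\<infinity>\<close>.\<close>
  then obtain b where b: "conj_fun M E \<phi> g = ereal b"
    using conj_fun_not_MInf[OF proper, of g] by (cases "conj_fun M E \<phi> g") auto
  obtain r where r: "c < ereal r" "ereal r < ereal (pairing M f g) - conj_fun M E \<phi> g"
    using g(2) ereal_dense2 by blast
  define U where "U = {h \<in> E. r + b < pairing M h g}"
  have "openin T U"
    using openin_continuous_map_preimage[OF continuous_map_pairing[OF g(1)], of "{r + b<..}"]
    by (simp add: U_def topspace_T)
  moreover have "f \<in> U"
    using f r(2) by (simp add: U_def b)
  moreover have "c < \<phi> h" if "h \<in> U" for h
  proof -
    have "ereal r \<le> ereal (pairing M h g) - conj_fun M E \<phi> g"
      using that by (simp add: b U_def)
    also have "\<dots> \<le> \<phi> h"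
      using that by (intro Young proper) (simp add: U_def)
    finally show ?thesis using r(1) by (rule less_le_trans[rotated])
  qed
  ultimately show "\<exists>U. openin T U \<and> f \<in> U \<and> (\<forall>h\<in>U. c < \<phi> h)" by blast
qed

end

theorem theorem5p5:
  fixes M :: "'a measure" and K F :: "('a \<Rightarrow> real) set"
    and \<phi> :: "('a \<Rightarrow> real) \<Rightarrow> ereal" and T :: "('a \<Rightarrow> real) topology"
  assumes "prob_space M" and "complete_measure M"
    and "abs_convex K" and "closed_in_prob M K" and "bounded_in_prob M K"
    and "convex_fun (fspan K) \<phi>" and "proper_fun (fspan K) \<phi>"
    and "\<forall>f\<in>fspan K. \<forall>h\<in>fspan K. (AE x in M. f x = h x) \<longrightarrow> \<phi> f = \<phi> h"
    and "locally_convex_top (fspan K) T" and "equicont_Koethe M K T"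
    and "Krein_Smulian K T" and "F_regular M K F T"
  shows "(lsc_top T \<phi> \<longleftrightarrow>
            (\<forall>f\<in>fspan K. \<phi> f = (SUP g\<in>F. ereal (pairing M f g) - conj_fun M (fspan K) \<phi> g)))
       \<and> (lsc_top T \<phi> \<longleftrightarrow> equicont_Fatou M K \<phi>)"
proof -
  interpret prob_space M by fact
  interpret Koethe_topology M K F T
    using assms by unfold_locales (auto simp: F_regular_def)
  show ?thesis
    using assms(6-8,12) lsc_imp_dual_representation dual_representation_imp_lsc
      lsc_imp_Fatou Fatou_imp_lsc by blast
qed

end
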